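(* Let $G$ be a group that can be written as a strongly irreducible extension $1\to N\to G\to Q\to 1$, where $N$ is a nilpotent group. Let $\mathcal{L}\subset N$ be a subset on which the projection $N\to N^{ab}/T(N^{ab})$ is injective. Then $\mathcal{L}$ is a non-foldable subset of $G$.
   Context: $N^{ab}=N/[N,N]$ is the abelianization and $T(N^{ab})$ the subgroup of elements of finite order of $N^{ab}$. A linear representation $\rho:Q\to \mathrm{GL}(V)$ on a finite-dimensional vector space $V$ is strongly irreducible if its image does not preserve any finite union of non-trivial proper subspaces of $V$; equivalently, every finite index subgroup of the image preserves no non-trivial proper subspace of $V$. An extension $1\to N\to G\to Q\to 1$ is strongly irreducible if $\dim_{\mathbb{Q}}(N^{ab}\otimes\mathbb{Q})<\infty$ and the linear representation $Q\to\mathrm{GL}(N^{ab}\otimes\mathbb{Q})$ induced by the conjugation action of $G$ on $N$ is strongly irreducible. A $G$-set is a non-empty set with a $G$-action (not necessarily transitive); it is faithful if only the identity of $G$ acts trivially. A subset $\mathcal{L}$ of a group $G$ is non-foldable if for every faithful $G$-set $X$ and every finite subset $\Sigma\subset\mathcal{L}$ there exists $x\in X$ such that the map $\Sigma\to X$, $g\mapsto gx$, is injective. *)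

theory Defs
  imports
    "HOL-Algebra.Group_Action"
    "HOL-Algebra.Generated_Groups"
    "HOL-Algebra.Free_Abelian_Groups"
    "HOL-Algebra.Algebraic_Closure_Type"
    "Jordan_Normal_Form.Missing_VectorSpace"
begin

section \<open>Abelianization, torsion and nilpotency\<close>

definition abelianization :: "('a, 'm) monoid_scheme \<Rightarrow> 'a set monoid"
  where "abelianization N = N Mod derived N (carrier N)"

definition torsion :: "('a, 'm) monoid_scheme \<Rightarrow> 'a set"
  where "torsion A = {a \<in> carrier A. \<exists>n::nat. n > 0 \<and> a [^]\<^bsub>A\<^esub> n = \<one>\<^bsub>A\<^esub>}"

definition ab_mod_torsion_proj :: "('a, 'm) monoid_scheme \<Rightarrow> 'a \<Rightarrow> 'a set set"
  where "ab_mod_torsion_proj N x =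
    torsion (abelianization N) #>\<^bsub>abelianization N\<^esub> (derived N (carrier N) #>\<^bsub>N\<^esub> x)"

definition mixed_commutator :: "('a, 'm) monoid_scheme \<Rightarrow> 'a set \<Rightarrow> 'a set \<Rightarrow> 'a set"
  where "mixed_commutator N H K = generate N
    {h \<otimes>\<^bsub>N\<^esub> k \<otimes>\<^bsub>N\<^esub> inv\<^bsub>N\<^esub> h \<otimes>\<^bsub>N\<^esub> inv\<^bsub>N\<^esub> k | h k. h \<in> H \<and> k \<in> K}"

primrec lower_central :: "('a, 'm) monoid_scheme \<Rightarrow> nat \<Rightarrow> 'a set"
  where
    "lower_central N 0 = carrier N"
  | "lower_central N (Suc n) = mixed_commutator N (carrier N) (lower_central N n)"

definition nilpotent_group :: "('a, 'm) monoid_scheme \<Rightarrow> bool"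
  where "nilpotent_group N \<longleftrightarrow> group N \<and> (\<exists>c. lower_central N c = {\<one>\<^bsub>N\<^esub>})"


section \<open>Tensor products of abelian groups and rationalization\<close>

text \<open>Abelian groups are written multiplicatively, as HOL-Algebra monoids. The tensor product is
  the free abelian group on \<open>carrier A \<times> carrier B\<close> modulo the bilinearity relations.\<close>

definition tensor_relations ::
    "('a, 'm) monoid_scheme \<Rightarrow> ('b, 'n) monoid_scheme \<Rightarrow> ('a \<times> 'b \<Rightarrow>\<^sub>0 int) set"
  where "tensor_relations A B = generate (free_Abelian_group (carrier A \<times> carrier B))
    ({frag_of (a \<otimes>\<^bsub>A\<^esub> a', b) - frag_of (a, b) - frag_of (a', b) | a a' b.
        a \<in> carrier A \<and> a' \<in> carrier A \<and> b \<in> carrier B} \<union>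
     {frag_of (a, b \<otimes>\<^bsub>B\<^esub> b') - frag_of (a, b) - frag_of (a, b') | a b b'.
        a \<in> carrier A \<and> b \<in> carrier B \<and> b' \<in> carrier B})"

definition tensor_group ::
    "('a, 'm) monoid_scheme \<Rightarrow> ('b, 'n) monoid_scheme \<Rightarrow> ('a \<times> 'b \<Rightarrow>\<^sub>0 int) set monoid"
  where "tensor_group A B =
    free_Abelian_group (carrier A \<times> carrier B) Mod tensor_relations A B"

text \<open>The endomorphism \<open>f \<otimes> g\<close> of \<open>A \<otimes> B\<close> for endomorphisms \<open>f\<close> of \<open>A\<close> and \<open>g\<close> of \<open>B\<close>: the
  coset of a formal sum \<open>\<Sum> k\<^sub>i (a\<^sub>i, b\<^sub>i)\<close> goes to the coset of \<open>\<Sum> k\<^sub>i (f a\<^sub>i, g b\<^sub>i)\<close>.\<close>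

definition tensor_endo ::
    "('a, 'm) monoid_scheme \<Rightarrow> ('b, 'n) monoid_scheme \<Rightarrow> ('a \<Rightarrow> 'a) \<Rightarrow> ('b \<Rightarrow> 'b) \<Rightarrow>
      ('a \<times> 'b \<Rightarrow>\<^sub>0 int) set \<Rightarrow> ('a \<times> 'b \<Rightarrow>\<^sub>0 int) set"
  where "tensor_endo A B f g = (\<lambda>C \<in> carrier (tensor_group A B).
    tensor_relations A B <#>\<^bsub>free_Abelian_group (carrier A \<times> carrier B)\<^esub>
      (frag_extend (\<lambda>(a, b). frag_of (f a, g b)) ` C))"

abbreviation rat_field :: "rat ring"
  where "rat_field \<equiv> ring_of_type_algebra"

text \<open>\<open>A \<otimes> \<rat>\<close> as a vector space over \<open>\<rat>\<close>, with \<open>c (a \<otimes> r) = a \<otimes> c r\<close>. The record type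
  \<open>module\<close> extends \<open>ring\<close>; its multiplicative components play no role for a module.\<close>

definition rationalization ::
    "('a, 'm) monoid_scheme \<Rightarrow> (rat, ('a \<times> rat \<Rightarrow>\<^sub>0 int) set) module"
  where "rationalization A =
    \<lparr>carrier = carrier (tensor_group A (add_monoid rat_field)),
     monoid.mult = undefined, one = undefined,
     zero = \<one>\<^bsub>tensor_group A (add_monoid rat_field)\<^esub>,
     add = (\<otimes>\<^bsub>tensor_group A (add_monoid rat_field)\<^esub>),
     module.smult = (\<lambda>c. tensor_endo A (add_monoid rat_field) id (\<lambda>r. c * r))\<rparr>"


section \<open>Linear representations and strong irreducibility\<close>

definition general_linear_group ::
    "('k, 'm) ring_scheme \<Rightarrow> ('k, 'v, 'n) module_scheme \<Rightarrow> ('v \<Rightarrow> 'v) monoid"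
  where "general_linear_group K V =
    BijGroup (carrier V) \<lparr>carrier := Bij (carrier V) \<inter> module_hom K V V\<rparr>"

locale linear_representation =
  fixes Q :: "('q, 'l) monoid_scheme" and K :: "('k, 'm) ring_scheme"
    and V :: "('k, 'v, 'n) module_scheme" and \<rho> :: "'q \<Rightarrow> 'v \<Rightarrow> 'v"
  assumes group: "group Q"
    and vectorspace: "vectorspace K V"
    and hom: "\<rho> \<in> hom Q (general_linear_group K V)"
begin

text \<open>Without the condition \<open>F \<noteq> {}\<close> the empty union would always be preserved.\<close>

definition strongly_irreducible :: bool
  where "strongly_irreducible \<longleftrightarrow>
    (\<forall>F. finite F \<and> F \<noteq> {} \<and>
      (\<forall>W\<in>F. VectorSpace.subspace K W V \<and> W \<noteq> {\<zero>\<^bsub>V\<^esub>} \<and> W \<noteq> carrier V) \<longrightarrow>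
      \<not> (\<forall>q\<in>carrier Q. \<rho> q ` \<Union>F = \<Union>F))"

end


section \<open>Strongly irreducible extensions\<close>

definition group_extension ::
    "'g set \<Rightarrow> ('g, 'm) monoid_scheme \<Rightarrow> ('q, 'n) monoid_scheme \<Rightarrow> ('g \<Rightarrow> 'q) \<Rightarrow> bool"
  where "group_extension N G Q \<pi> \<longleftrightarrow>
    group G \<and> group Q \<and> \<pi> \<in> epi G Q \<and> kernel G Q \<pi> = N"

definition conj_coset :: "('g, 'm) monoid_scheme \<Rightarrow> 'g \<Rightarrow> 'g set \<Rightarrow> 'g set"
  where "conj_coset G g C = (\<lambda>n. g \<otimes>\<^bsub>G\<^esub> n \<otimes>\<^bsub>G\<^esub> inv\<^bsub>G\<^esub> g) ` C"

text \<open>\<open>q \<in> Q\<close> acts on \<open>N\<^sup>a\<^sup>b\<close> by conjugation by any lift of \<open>q\<close> to \<open>G\<close>; the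
  result does not depend on the lift, since \<open>N\<close> acts trivially on \<open>N\<^sup>a\<^sup>b\<close>
  (lemma \<open>conj_rep_lift\<close>).\<close>

definition conj_rep ::
    "'g set \<Rightarrow> ('g, 'm) monoid_scheme \<Rightarrow> ('g \<Rightarrow> 'q) \<Rightarrow> 'q \<Rightarrow>
      ('g set \<times> rat \<Rightarrow>\<^sub>0 int) set \<Rightarrow> ('g set \<times> rat \<Rightarrow>\<^sub>0 int) set"
  where "conj_rep N G \<pi> q =
    tensor_endo (abelianization (G\<lparr>carrier := N\<rparr>)) (add_monoid rat_field)
      (conj_coset G (inv_into (carrier G) \<pi> q)) id"

definition strongly_irreducible_extension ::
    "'g set \<Rightarrow> ('g, 'm) monoid_scheme \<Rightarrow> ('q, 'n) monoid_scheme \<Rightarrow> ('g \<Rightarrow> 'q) \<Rightarrow> bool"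
  where "strongly_irreducible_extension N G Q \<pi> \<longleftrightarrow>
    group_extension N G Q \<pi> \<and>
    vectorspace.fin_dim rat_field (rationalization (abelianization (G\<lparr>carrier := N\<rparr>))) \<and>
    linear_representation.strongly_irreducible Q rat_field
      (rationalization (abelianization (G\<lparr>carrier := N\<rparr>))) (conj_rep N G \<pi>)"


section \<open>Non-foldable subsets\<close>

text \<open>HOL cannot quantify over types inside a formula, so the type \<open>'x\<close> of the points of the
  \<open>G\<close>-sets is a parameter. In a theorem it has to be a type variable that does not occur elsewhere,
  so that \<open>G\<close>-sets on all types are covered.\<close>

definition non_foldable :: "'x itself \<Rightarrow> ('g, 'm) monoid_scheme \<Rightarrow> 'g set \<Rightarrow> bool"
  where "non_foldable _ G L \<longleftrightarrow> L \<subseteq> carrier G \<and>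
    (\<forall>(E :: 'x set) \<phi> \<Sigma>. E \<noteq> {} \<and> faithful_action G E \<phi> \<and> finite \<Sigma> \<and> \<Sigma> \<subseteq> L \<longrightarrow>
      (\<exists>x\<in>E. inj_on (\<lambda>g. \<phi> g x) \<Sigma>))"


section \<open>The conjugation representation is well defined\<close>

lemma tensor_relations_normal:
  "tensor_relations A B \<lhd> free_Abelian_group (carrier A \<times> carrier B)"
  if "group A" "group B"
proof -
  let ?F = "free_Abelian_group (carrier A \<times> carrier B)"
  interpret A: group A by fact
  interpret B: group B by fact
  interpret F: comm_group ?F by (rule abelian_free_Abelian_group)
  have "subgroup (tensor_relations A B) ?F"
    unfolding tensor_relations_def
  proof (rule F.generate_is_subgroup)
    have k: "frag_of p - frag_of q - frag_of r \<in> carrier ?F"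
      if "p \<in> carrier A \<times> carrier B" "q \<in> carrier A \<times> carrier B" "r \<in> carrier A \<times> carrier B" for p q r
    proof -
      have "frag_of p \<otimes>\<^bsub>?F\<^esub> inv\<^bsub>?F\<^esub> (frag_of q) \<otimes>\<^bsub>?F\<^esub> inv\<^bsub>?F\<^esub> (frag_of r) \<in> carrier ?F"
        using that by (intro F.m_closed F.inv_closed) (simp_all only: frag_of_in_free_Abelian_group)
      then show ?thesis using that by simp
    qed
    show "{frag_of (a \<otimes>\<^bsub>A\<^esub> a', b) - frag_of (a, b) - frag_of (a', b) | a a' b.
        a \<in> carrier A \<and> a' \<in> carrier A \<and> b \<in> carrier B} \<union>
     {frag_of (a, b \<otimes>\<^bsub>B\<^esub> b') - frag_of (a, b) - frag_of (a, b') | a b b'.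
        a \<in> carrier A \<and> b \<in> carrier B \<and> b' \<in> carrier B} \<subseteq> carrier ?F"
      by (auto simp del: carrier_free_Abelian_group_iff intro!: k)
  qed
  then show ?thesis by (simp add: F.normal_iff_subgroup)
qed

context
  fixes A :: "('a, 'm) monoid_scheme" and B :: "('b, 'n) monoid_scheme"
  assumes A: "group A" and B: "group B"
begin

interpretation A: group A by (rule A)
interpretation B: group B by (rule B)
private abbreviation (input) "FF \<equiv> free_Abelian_group (carrier A \<times> carrier B)"
private abbreviation (input) "RR \<equiv> tensor_relations A B"
private abbreviation (input) "ext f g \<equiv> frag_extend (\<lambda>(a, b). frag_of (f a, g b))"
interpretation F: comm_group FF by (rule abelian_free_Abelian_group)
interpretation R: normal RR FF by (rule tensor_relations_normal[OF A B])

lemma tensor_comm_group: "comm_group (tensor_group A B)"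
  unfolding tensor_group_def by (rule F.abelian_FactGroup) (rule R.subgroup_axioms)

lemma carrier_tensor: "carrier (tensor_group A B) = (\<lambda>x. RR #>\<^bsub>FF\<^esub> x) ` carrier FF"
  by (simp add: tensor_group_def carrier_FactGroup)

lemma mult_tensor_coset:
  "x \<in> carrier FF \<Longrightarrow> y \<in> carrier FF \<Longrightarrow>
    (RR #>\<^bsub>FF\<^esub> x) \<otimes>\<^bsub>tensor_group A B\<^esub> (RR #>\<^bsub>FF\<^esub> y) = RR #>\<^bsub>FF\<^esub> (x + y)"
  by (simp only: tensor_group_def mult_FactGroup R.rcos_sum mult_free_Abelian_group)

lemma ext_closed: "f \<in> carrier A \<rightarrow> carrier A \<Longrightarrow> g \<in> carrier B \<rightarrow> carrier B \<Longrightarrow> x \<in> carrier FF \<Longrightarrow> ext f g x \<in> carrier FF"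
proof -
  assume f: "f \<in> carrier A \<rightarrow> carrier A" and g: "g \<in> carrier B \<rightarrow> carrier B" and x: "x \<in> carrier FF"
  have "Poly_Mapping.keys (case p of (a, b) \<Rightarrow> frag_of (f a, g b)) \<subseteq> carrier A \<times> carrier B"
    if "p \<in> Poly_Mapping.keys x" for p
    using subsetD[OF x[simplified] that] f g by (auto split: prod.splits)
  then have "(\<Union>p\<in>Poly_Mapping.keys x. Poly_Mapping.keys (case p of (a, b) \<Rightarrow> frag_of (f a, g b)))
      \<subseteq> carrier A \<times> carrier B" by (rule UN_least)
  with keys_frag_extend show ?thesis unfolding carrier_free_Abelian_group_iff by (rule order_trans)
qed

lemma ext_RR:
  assumes f: "f \<in> hom A A" and g: "g \<in> hom B B" and x: "x \<in> RR"
  shows "ext f g x \<in> RR"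
proof -
  have fA: "f a \<in> carrier A" if "a \<in> carrier A" for a using f that by (auto simp: hom_def)
  have gB: "g b \<in> carrier B" if "b \<in> carrier B" for b using g that by (auto simp: hom_def)
  have fm: "f (a \<otimes>\<^bsub>A\<^esub> a') = f a \<otimes>\<^bsub>A\<^esub> f a'" if "a \<in> carrier A" "a' \<in> carrier A" for a a'
    using f that by (auto simp: hom_def)
  have gm: "g (b \<otimes>\<^bsub>B\<^esub> b') = g b \<otimes>\<^bsub>B\<^esub> g b'" if "b \<in> carrier B" "b' \<in> carrier B" for b b'
    using g that by (auto simp: hom_def)
  define S1 where "S1 = {frag_of (a \<otimes>\<^bsub>A\<^esub> a', b) - frag_of (a, b) - frag_of (a', b) | a a' b.
        a \<in> carrier A \<and> a' \<in> carrier A \<and> b \<in> carrier B}"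
  define S2 where "S2 = {frag_of (a, b \<otimes>\<^bsub>B\<^esub> b') - frag_of (a, b) - frag_of (a, b') | a b b'.
        a \<in> carrier A \<and> b \<in> carrier B \<and> b' \<in> carrier B}"
  have RS: "RR = generate FF (S1 \<union> S2)" by (simp add: tensor_relations_def S1_def S2_def)
  have gen: "ext f g h \<in> RR" if "h \<in> S1 \<union> S2" for h
  proof -
    from that have "ext f g h \<in> S1 \<union> S2"
    proof
      assume "h \<in> S1"
      then obtain a a' b where h: "h = frag_of (a \<otimes>\<^bsub>A\<^esub> a', b) - frag_of (a, b) - frag_of (a', b)"
        "a \<in> carrier A" "a' \<in> carrier A" "b \<in> carrier B" unfolding S1_def by blast
      have "ext f g h = frag_of (f a \<otimes>\<^bsub>A\<^esub> f a', g b) - frag_of (f a, g b) - frag_of (f a', g b)"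
        using h(2-4) unfolding h(1) frag_extend_diff frag_extend_of prod.case by (simp only: fm)
      then have "ext f g h \<in> S1" unfolding S1_def using fA gB h(2-4) by blast
      then show ?thesis ..
    next
      assume "h \<in> S2"
      then obtain a b b' where h: "h = frag_of (a, b \<otimes>\<^bsub>B\<^esub> b') - frag_of (a, b) - frag_of (a, b')"
        "a \<in> carrier A" "b \<in> carrier B" "b' \<in> carrier B" unfolding S2_def by blast
      have "ext f g h = frag_of (f a, g b \<otimes>\<^bsub>B\<^esub> g b') - frag_of (f a, g b) - frag_of (f a, g b')"
        using h(2-4) unfolding h(1) frag_extend_diff frag_extend_of prod.case by (simp only: gm)
      then have "ext f g h \<in> S2" unfolding S2_def using fA gB h(2-4) by blast
      then show ?thesis ..
    qed
    then show ?thesis unfolding RS by (rule generate.incl)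
  qed
  have neg: "- r \<in> RR" if "r \<in> RR" for r
    using R.m_inv_closed[OF that] subsetD[OF R.subset that] by simp
  have add: "r + s \<in> RR" if "r \<in> RR" "s \<in> RR" for r s
    using R.m_closed[OF that] by simp
  have "x \<in> generate FF (S1 \<union> S2)" using x by (simp only: RS)
  then show ?thesis
  proof (induction rule: generate.induct)
    case one then show ?case using R.one_closed by simp
  next
    case (incl h)
    then show ?case by (rule gen)
  next
    case (inv h)
    have "h \<in> RR" unfolding RS using inv by (rule generate.incl)
    then have "h \<in> carrier FF" by (rule subsetD[OF R.subset])
    then have "inv\<^bsub>FF\<^esub> h = - h" by simp
    then show ?case using neg[OF gen[OF inv]] by (simp only: frag_extend_minus)
  next
    case (eng h1 h2)
    then show ?case using add[OF eng(3,4)] by (simp only: mult_free_Abelian_group frag_extend_add)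
  qed
qed

lemma tensor_endo_coset:
  assumes f: "f \<in> hom A A" and g: "g \<in> hom B B" and x: "x \<in> carrier FF"
  shows "tensor_endo A B f g (RR #>\<^bsub>FF\<^esub> x) = RR #>\<^bsub>FF\<^esub> ext f g x"
proof -
  have fc: "f \<in> carrier A \<rightarrow> carrier A" and gc: "g \<in> carrier B \<rightarrow> carrier B"
    using f g by (auto simp: hom_def)
  have "tensor_endo A B f g (RR #>\<^bsub>FF\<^esub> x) = RR <#>\<^bsub>FF\<^esub> (ext f g ` (RR #>\<^bsub>FF\<^esub> x))"
    using x by (simp add: tensor_endo_def carrier_tensor)
  also have "\<dots> = RR #>\<^bsub>FF\<^esub> ext f g x"
  proof (intro equalityI subsetI)
    fix y assume "y \<in> RR <#>\<^bsub>FF\<^esub> (ext f g ` (RR #>\<^bsub>FF\<^esub> x))"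
    then obtain r s where r: "r \<in> RR" "s \<in> RR" "y = r + ext f g (s + x)"
      by (auto simp: set_mult_def r_coset_def)
    then have "y = (r + ext f g s) + ext f g x" by (simp add: frag_extend_add algebra_simps)
    moreover have "r + ext f g s \<in> RR"
      using R.m_closed[OF r(1) ext_RR[OF f g r(2)]] by simp
    ultimately show "y \<in> RR #>\<^bsub>FF\<^esub> ext f g x" by (auto simp: r_coset_def)
  next
    fix y assume "y \<in> RR #>\<^bsub>FF\<^esub> ext f g x"
    then obtain r where r: "r \<in> RR" "y = r + ext f g x" by (auto simp: r_coset_def)
    have "x \<in> RR #>\<^bsub>FF\<^esub> x" using x by (intro F.rcos_self R.subgroup_axioms)
    then show "y \<in> RR <#>\<^bsub>FF\<^esub> (ext f g ` (RR #>\<^bsub>FF\<^esub> x))"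
      using r by (auto simp: set_mult_def)
  qed
  finally show ?thesis .
qed

lemma tensor_endo_hom:
  assumes f: "f \<in> hom A A" and g: "g \<in> hom B B"
  shows "tensor_endo A B f g \<in> hom (tensor_group A B) (tensor_group A B)"
proof (rule homI)
  have fc: "f \<in> carrier A \<rightarrow> carrier A" and gc: "g \<in> carrier B \<rightarrow> carrier B"
    using f g by (auto simp: hom_def)
  note cl = ext_closed[OF fc gc]
  show "tensor_endo A B f g u \<in> carrier (tensor_group A B)" if "u \<in> carrier (tensor_group A B)" for u
    using that cl by (auto simp del: carrier_free_Abelian_group_iff simp: carrier_tensor tensor_endo_coset[OF f g])
  fix u v assume "u \<in> carrier (tensor_group A B)" "v \<in> carrier (tensor_group A B)"
  then obtain x y where x: "x \<in> carrier FF" "u = RR #>\<^bsub>FF\<^esub> x" and y: "y \<in> carrier FF" "v = RR #>\<^bsub>FF\<^esub> y"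
    unfolding carrier_tensor by blast
  have "x + y \<in> carrier FF" using F.m_closed[OF x(1) y(1)] by simp
  then show "tensor_endo A B f g (u \<otimes>\<^bsub>tensor_group A B\<^esub> v) =
      tensor_endo A B f g u \<otimes>\<^bsub>tensor_group A B\<^esub> tensor_endo A B f g v"
    unfolding x(2) y(2) tensor_endo_coset[OF f g x(1)] tensor_endo_coset[OF f g y(1)]
    using cl[OF x(1)] cl[OF y(1)]
    by (simp only: mult_tensor_coset x(1) y(1) tensor_endo_coset[OF f g] frag_extend_add)
qed

lemma tensor_endo_comp:
  assumes f: "f \<in> hom A A" and g: "g \<in> hom B B" and f': "f' \<in> hom A A" and g': "g' \<in> hom B B"
   and u: "u \<in> carrier (tensor_group A B)"
  shows "tensor_endo A B f g (tensor_endo A B f' g' u) = tensor_endo A B (f \<circ> f') (g \<circ> g') u"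
proof -
  obtain x where x: "x \<in> carrier FF" "u = RR #>\<^bsub>FF\<^esub> x" using u unfolding carrier_tensor by blast
  have fc: "f' \<in> carrier A \<rightarrow> carrier A" and gc: "g' \<in> carrier B \<rightarrow> carrier B"
    using f' g' by (auto simp: hom_def)
  have "f \<circ> f' \<in> hom A A" "g \<circ> g' \<in> hom B B" using f f' g g' hom_compose by blast+
  moreover have "ext f g (ext f' g' x) = ext (f \<circ> f') (g \<circ> g') x"
  proof -
    have *: "Poly_Mapping.keys x \<subseteq> UNIV" by simp
    from this show ?thesis 
      by (induction x rule: frag_induction) (auto simp: frag_extend_diff)
  qed
  ultimately show ?thesis
    using ext_closed[OF fc gc x(1)] x
    by (simp del: carrier_free_Abelian_group_iff add: tensor_endo_coset f g f' g')
qed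

lemma tensor_endo_cong:
  assumes f: "f \<in> hom A A" and g: "g \<in> hom B B" and f': "f' \<in> hom A A" and g': "g' \<in> hom B B"
   and "\<And>a. a \<in> carrier A \<Longrightarrow> f a = f' a" "\<And>b. b \<in> carrier B \<Longrightarrow> g b = g' b"
  shows "tensor_endo A B f g = tensor_endo A B f' g'"
proof 
  fix u
  show "tensor_endo A B f g u = tensor_endo A B f' g' u"
  proof (cases "u \<in> carrier (tensor_group A B)")
    case True
    then obtain x where x: "x \<in> carrier FF" "u = RR #>\<^bsub>FF\<^esub> x" unfolding carrier_tensor by blast
    have "ext f g x = ext f' g' x"
      by (rule frag_extend_eq) (use x assms in auto)
    then show ?thesis using x by (simp del: carrier_free_Abelian_group_iff add: tensor_endo_coset f g f' g')
  qed (simp add: tensor_endo_def)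
qed

lemma tensor_endo_id:
  assumes u: "u \<in> carrier (tensor_group A B)"
  shows "tensor_endo A B id id u = u"
proof -
  obtain x where x: "x \<in> carrier FF" "u = RR #>\<^bsub>FF\<^esub> x" using u unfolding carrier_tensor by blast
  have "id \<in> hom A A" "id \<in> hom B B" by (auto simp: hom_def)
  moreover have "ext id id x = x" using frag_expansion[of x] by (simp add: case_prod_unfold)
  ultimately show ?thesis using x(1) unfolding x(2) by (simp del: carrier_free_Abelian_group_iff add: tensor_endo_coset)
qed

lemma tensor_endo_add:
  assumes f: "f \<in> hom A A" and g: "g \<in> hom B B" and g': "g' \<in> hom B B" and h: "h \<in> hom B B"
   and hh: "\<And>b. b \<in> carrier B \<Longrightarrow> h b = g b \<otimes>\<^bsub>B\<^esub> g' b"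
   and u: "u \<in> carrier (tensor_group A B)"
  shows "tensor_endo A B f h u = tensor_endo A B f g u \<otimes>\<^bsub>tensor_group A B\<^esub> tensor_endo A B f g' u"
proof -
  obtain x where x: "x \<in> carrier FF" "u = RR #>\<^bsub>FF\<^esub> x" using u unfolding carrier_tensor by blast
  have c: "f \<in> carrier A \<rightarrow> carrier A" "g \<in> carrier B \<rightarrow> carrier B" "g' \<in> carrier B \<rightarrow> carrier B"  "h \<in> carrier B \<rightarrow> carrier B"
    using f g g' h by (auto simp: hom_def)
  have e: "ext f h x - (ext f g x + ext f g' x) \<in> RR"
    using x(1)[simplified]
  proof (induction x rule: free_Abelian_group_induct[consumes 1])
    case 1
    then show ?case using R.one_closed by simp
  next
    case (2 x y)
    have "(ext f h x - (ext f g x + ext f g' x)) - (ext f h y - (ext f g y + ext f g' y)) \<in> RR"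
      using R.m_closed[OF 2(3) R.m_inv_closed[OF 2(4)]] subsetD[OF R.subset 2(4)]
      by (simp only: mult_free_Abelian_group inv_free_Abelian_group carrier_free_Abelian_group_iff add_uminus_conv_diff)
    then show ?case by (simp add: frag_extend_diff algebra_simps)
  next
    case (3 p)
    obtain a b where p: "p = (a, b)" "a \<in> carrier A" "b \<in> carrier B" using 3 by auto
    have "frag_of (f a, g b \<otimes>\<^bsub>B\<^esub> g' b) - frag_of (f a, g b) - frag_of (f a, g' b) \<in> RR"
      unfolding tensor_relations_def
    proof (rule generate.incl, rule UnI2)
      have "f a \<in> carrier A" "g b \<in> carrier B" "g' b \<in> carrier B" using p c by auto
      then show "frag_of (f a, g b \<otimes>\<^bsub>B\<^esub> g' b) - frag_of (f a, g b) - frag_of (f a, g' b) \<in>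
        {frag_of (a, b \<otimes>\<^bsub>B\<^esub> b') - frag_of (a, b) - frag_of (a, b') | a b b'.
          a \<in> carrier A \<and> b \<in> carrier B \<and> b' \<in> carrier B}" by blast
    qed
    then show ?case using p(3) unfolding p(1) by (simp only: hh frag_extend_of prod.case diff_diff_add)
  qed
  have cl: "ext f h x \<in> carrier FF" "ext f g x \<in> carrier FF" "ext f g' x \<in> carrier FF"
    using c x(1) by (blast intro: ext_closed)+
  have sm: "ext f g x + ext f g' x \<in> carrier FF" using F.m_closed[OF cl(2,3)] by simp
  have "ext f h x \<in> RR #>\<^bsub>FF\<^esub> (ext f g x + ext f g' x)"
    using e by (auto simp: r_coset_def intro!: bexI[of _ "ext f h x - (ext f g x + ext f g' x)"])
  then have "RR #>\<^bsub>FF\<^esub> (ext f g x + ext f g' x) = RR #>\<^bsub>FF\<^esub> ext f h x"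
    by (rule F.repr_independence[OF _ sm R.subgroup_axioms])
  then show ?thesis using x cl
    by (simp only: tensor_endo_coset f g g' h mult_tensor_coset)
qed

end


lemma rat_field_simps:
  "carrier rat_field = UNIV" "x \<otimes>\<^bsub>rat_field\<^esub> y = x * y" "x \<oplus>\<^bsub>rat_field\<^esub> y = x + y"
  "\<one>\<^bsub>rat_field\<^esub> = 1" "\<zero>\<^bsub>rat_field\<^esub> = 0"
  by (simp_all add: ring_of_type_algebra_def)

lemma rat_add_group: "group (add_monoid rat_field)"
  by (rule groupI) (auto intro: exI[of _ "- x" for x] simp: add.assoc rat_field_simps)

lemma rat_mult_hom: "(\<lambda>r. c * r) \<in> hom (add_monoid rat_field) (add_monoid rat_field)"
  by (auto simp: hom_def distrib_left rat_field_simps)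

lemma id_hom: "id \<in> hom A A"
  by (auto simp: hom_def)

theorem vectorspace_rationalization:
  assumes A: "group A"
  shows "vectorspace rat_field (rationalization A)"
proof -
  let ?Q = "add_monoid rat_field"
  let ?T = "tensor_group A ?Q"
  interpret T: comm_group ?T by (rule tensor_comm_group[OF A rat_add_group])
  note hom = tensor_endo_hom[OF A rat_add_group id_hom rat_mult_hom]
  have s: "carrier (rationalization A) = carrier ?T" "x \<oplus>\<^bsub>rationalization A\<^esub> y = x \<otimes>\<^bsub>?T\<^esub> y"
    "\<zero>\<^bsub>rationalization A\<^esub> = \<one>\<^bsub>?T\<^esub>" "c \<odot>\<^bsub>rationalization A\<^esub> x = tensor_endo A ?Q id (\<lambda>r. c * r) x" for x y c
    by (simp_all add: rationalization_def)
  have "module rat_field (rationalization A)"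
  proof (rule moduleI)
    show "cring rat_field" by (rule cring_from_type_algebra)
    show "abelian_group (rationalization A)"
    proof (rule abelian_groupI, unfold s)
      fix x y assume "x \<in> carrier ?T" "y \<in> carrier ?T"
      then show "x \<otimes>\<^bsub>?T\<^esub> y = y \<otimes>\<^bsub>?T\<^esub> x" by (rule T.m_comm)
    next
      fix x assume x: "x \<in> carrier ?T"
      show "\<one>\<^bsub>?T\<^esub> \<otimes>\<^bsub>?T\<^esub> x = x" using x by (rule T.l_one)
      show "\<exists>y\<in>carrier ?T. y \<otimes>\<^bsub>?T\<^esub> x = \<one>\<^bsub>?T\<^esub>" using x by (rule T.l_inv_ex)
      fix y assume y: "y \<in> carrier ?T"
      show "x \<otimes>\<^bsub>?T\<^esub> y \<in> carrier ?T" using x y by (rule T.m_closed)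
      fix z assume z: "z \<in> carrier ?T"
      show "x \<otimes>\<^bsub>?T\<^esub> y \<otimes>\<^bsub>?T\<^esub> z = x \<otimes>\<^bsub>?T\<^esub> (y \<otimes>\<^bsub>?T\<^esub> z)" using x y z by (rule T.m_assoc)
    qed (rule T.one_closed)
    fix a b :: rat and x y assume x: "x \<in> carrier (rationalization A)" 
    then have x': "x \<in> carrier ?T" by (simp only: s)
    show "a \<odot>\<^bsub>rationalization A\<^esub> x \<in> carrier (rationalization A)"
      unfolding s using hom x' by (rule hom_in_carrier)
    show "(a \<oplus>\<^bsub>rat_field\<^esub> b) \<odot>\<^bsub>rationalization A\<^esub> x =
       a \<odot>\<^bsub>rationalization A\<^esub> x \<oplus>\<^bsub>rationalization A\<^esub> b \<odot>\<^bsub>rationalization A\<^esub> x"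
      unfolding s by (rule tensor_endo_add[OF A rat_add_group id_hom rat_mult_hom rat_mult_hom rat_mult_hom _ x'])
         (simp add: distrib_right rat_field_simps)
    show "(a \<otimes>\<^bsub>rat_field\<^esub> b) \<odot>\<^bsub>rationalization A\<^esub> x =
       a \<odot>\<^bsub>rationalization A\<^esub> (b \<odot>\<^bsub>rationalization A\<^esub> x)"
    proof -
      have "(*) a \<circ> (*) b = (*) (a * b)" by (simp add: fun_eq_iff mult.assoc)
      then show ?thesis
        unfolding s tensor_endo_comp[OF A rat_add_group id_hom rat_mult_hom id_hom rat_mult_hom x']
        by (simp only: id_comp rat_field_simps)
    qed
    show "\<one>\<^bsub>rat_field\<^esub> \<odot>\<^bsub>rationalization A\<^esub> x = x"
    proof -
      have "(*) (1::rat) = id" by (simp add: fun_eq_iff)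
      then show ?thesis
        using tensor_endo_id[OF A rat_add_group x'] by (simp only: s rat_field_simps(4))
    qed
    assume "y \<in> carrier (rationalization A)"
    then have y': "y \<in> carrier ?T" by (simp only: s)
    show "a \<odot>\<^bsub>rationalization A\<^esub> (x \<oplus>\<^bsub>rationalization A\<^esub> y) =
      a \<odot>\<^bsub>rationalization A\<^esub> x \<oplus>\<^bsub>rationalization A\<^esub> a \<odot>\<^bsub>rationalization A\<^esub> y"
      unfolding s using hom x' y' by (rule hom_mult)
  qed
  then show ?thesis
    using field_from_type_algebra by (auto simp: vectorspace_def)
qed

context
  fixes N and G :: "('g, 'm) monoid_scheme" and Q :: "('q, 'n) monoid_scheme" and \<pi>
  assumes extension: "group_extension N G Q \<pi>"
begin

interpretation G: group G using extension by (simp add: group_extension_def)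
interpretation Q: group Q using extension by (simp add: group_extension_def)
interpretation pi: group_hom G Q \<pi>
  using extension by unfold_locales (auto simp: group_extension_def epi_def)
interpretation N: normal N G
  using pi.normal_kernel extension by (simp add: group_extension_def)
private abbreviation (input) "NG \<equiv> G\<lparr>carrier := N\<rparr>"
interpretation NG: group NG by (rule G.subgroup_imp_group[OF N.subgroup_axioms])
private abbreviation (input) "DD \<equiv> derived G N"
interpretation D: normal DD G by (rule G.derived_is_normal[OF N.normal_axioms])

lemma derived_NG: "derived NG (carrier NG) = DD"
  using G.derived_consistent[OF subset_refl N.subgroup_axioms] by simp

lemma abgroup: "comm_group (abelianization NG)"
  unfolding abelianization_def by (rule NG.derived_quot_is_comm_group)

lemma carrier_ab: "carrier (abelianization NG) = (\<lambda>n. DD #>\<^bsub>G\<^esub> n) ` N"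
  unfolding abelianization_def derived_NG carrier_FactGroup by (simp add: r_coset_def)

lemma mult_ab: 
  assumes "n \<in> N" "m \<in> N"
  shows "(DD #>\<^bsub>G\<^esub> n) \<otimes>\<^bsub>abelianization NG\<^esub> (DD #>\<^bsub>G\<^esub> m) = DD #>\<^bsub>G\<^esub> (n \<otimes>\<^bsub>G\<^esub> m)"
proof -
  have "(DD #>\<^bsub>G\<^esub> n) \<otimes>\<^bsub>abelianization NG\<^esub> (DD #>\<^bsub>G\<^esub> m) = (DD #>\<^bsub>G\<^esub> n) <#>\<^bsub>G\<^esub> (DD #>\<^bsub>G\<^esub> m)"
    unfolding abelianization_def mult_FactGroup by (simp add: set_mult_def)
  then show ?thesis using assms by (simp add: D.rcos_sum)
qed

lemma conj_coset_rcos: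
  assumes g: "g \<in> carrier G" and n: "n \<in> N"
  shows "conj_coset G g (DD #>\<^bsub>G\<^esub> n) = DD #>\<^bsub>G\<^esub> (g \<otimes>\<^bsub>G\<^esub> n \<otimes>\<^bsub>G\<^esub> inv\<^bsub>G\<^esub> g)"
proof (intro equalityI subsetI)
  have nG: "n \<in> carrier G" using n by simp
  fix x assume "x \<in> conj_coset G g (DD #>\<^bsub>G\<^esub> n)"
  then obtain d where d: "d \<in> DD" "x = g \<otimes>\<^bsub>G\<^esub> (d \<otimes>\<^bsub>G\<^esub> n) \<otimes>\<^bsub>G\<^esub> inv\<^bsub>G\<^esub> g"
    by (auto simp: conj_coset_def r_coset_def)
  have "x = (g \<otimes>\<^bsub>G\<^esub> d \<otimes>\<^bsub>G\<^esub> inv\<^bsub>G\<^esub> g) \<otimes>\<^bsub>G\<^esub> (g \<otimes>\<^bsub>G\<^esub> n \<otimes>\<^bsub>G\<^esub> inv\<^bsub>G\<^esub> g)"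
    using g nG D.mem_carrier[OF d(1)] unfolding d(2) by (simp add: G.m_assoc G.inv_solve_left)
  then show "x \<in> DD #>\<^bsub>G\<^esub> (g \<otimes>\<^bsub>G\<^esub> n \<otimes>\<^bsub>G\<^esub> inv\<^bsub>G\<^esub> g)"
    using D.inv_op_closed2[OF g d(1)] by (auto simp: r_coset_def)
next
  have nG: "n \<in> carrier G" using n by simp
  fix x assume "x \<in> DD #>\<^bsub>G\<^esub> (g \<otimes>\<^bsub>G\<^esub> n \<otimes>\<^bsub>G\<^esub> inv\<^bsub>G\<^esub> g)"
  then obtain d where d: "d \<in> DD" "x = d \<otimes>\<^bsub>G\<^esub> (g \<otimes>\<^bsub>G\<^esub> n \<otimes>\<^bsub>G\<^esub> inv\<^bsub>G\<^esub> g)"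
    by (auto simp: r_coset_def)
  define e where "e = inv\<^bsub>G\<^esub> g \<otimes>\<^bsub>G\<^esub> d \<otimes>\<^bsub>G\<^esub> g"
  have e: "e \<in> DD" unfolding e_def by (rule D.inv_op_closed1[OF g d(1)])
  have "g \<otimes>\<^bsub>G\<^esub> e = d \<otimes>\<^bsub>G\<^esub> g"
    using g D.mem_carrier[OF d(1)] by (simp add: e_def G.m_assoc[symmetric])
  then have "x = g \<otimes>\<^bsub>G\<^esub> (e \<otimes>\<^bsub>G\<^esub> n) \<otimes>\<^bsub>G\<^esub> inv\<^bsub>G\<^esub> g"
    using g nG D.mem_carrier[OF d(1)] D.mem_carrier[OF e] unfolding d(2) 
    by (metis G.inv_closed G.m_assoc G.m_closed)
  then show "x \<in> conj_coset G g (DD #>\<^bsub>G\<^esub> n)" using e by (auto simp: conj_coset_def r_coset_def)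
qed

lemma conj_coset_hom: assumes g: "g \<in> carrier G" shows "conj_coset G g \<in> hom (abelianization NG) (abelianization NG)"
proof (rule homI)
  fix x assume "x \<in> carrier (abelianization NG)"
  then show "conj_coset G g x \<in> carrier (abelianization NG)"
    using N.inv_op_closed2[OF g] by (auto simp: carrier_ab conj_coset_rcos[OF g])
next
  fix x y assume "x \<in> carrier (abelianization NG)" "y \<in> carrier (abelianization NG)"
  then obtain n m where n: "n \<in> N" "x = DD #>\<^bsub>G\<^esub> n" and m: "m \<in> N" "y = DD #>\<^bsub>G\<^esub> m"
    by (auto simp: carrier_ab)
  have "g \<otimes>\<^bsub>G\<^esub> (n \<otimes>\<^bsub>G\<^esub> m) \<otimes>\<^bsub>G\<^esub> inv\<^bsub>G\<^esub> g = (g \<otimes>\<^bsub>G\<^esub> n \<otimes>\<^bsub>G\<^esub> inv\<^bsub>G\<^esub> g) \<otimes>\<^bsub>G\<^esub> (g \<otimes>\<^bsub>G\<^esub> m \<otimes>\<^bsub>G\<^esub> inv\<^bsub>G\<^esub> g)"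
    using g n(1) m(1) by (simp add: G.m_assoc G.inv_solve_left)
  then show "conj_coset G g (x \<otimes>\<^bsub>abelianization NG\<^esub> y) = conj_coset G g x \<otimes>\<^bsub>abelianization NG\<^esub> conj_coset G g y"
    unfolding n(2) m(2) using n m N.inv_op_closed2[OF g] 
    by (simp only: mult_ab conj_coset_rcos g N.m_closed)
qed

lemma conj_coset_comp:
  assumes g: "g \<in> carrier G" and h: "h \<in> carrier G" and x: "x \<in> carrier (abelianization NG)"
  shows "conj_coset G (g \<otimes>\<^bsub>G\<^esub> h) x = conj_coset G g (conj_coset G h x)"
proof -
  obtain n where n: "n \<in> N" "x = DD #>\<^bsub>G\<^esub> n" using x by (auto simp: carrier_ab)
  have "(g \<otimes>\<^bsub>G\<^esub> h) \<otimes>\<^bsub>G\<^esub> n \<otimes>\<^bsub>G\<^esub> inv\<^bsub>G\<^esub> (g \<otimes>\<^bsub>G\<^esub> h) = g \<otimes>\<^bsub>G\<^esub> (h \<otimes>\<^bsub>G\<^esub> n \<otimes>\<^bsub>G\<^esub> inv\<^bsub>G\<^esub> h) \<otimes>\<^bsub>G\<^esub> inv\<^bsub>G\<^esub> g"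
    using g h n(1) by (simp add: G.m_assoc G.inv_mult_group)
  then show ?thesis
    unfolding n(2) using g h n(1) N.inv_op_closed2[OF h n(1)] by (simp only: conj_coset_rcos G.m_closed)
qed

lemma conj_coset_N:
  assumes k: "k \<in> N" and x: "x \<in> carrier (abelianization NG)"
  shows "conj_coset G k x = x"
proof -
  obtain n where n: "n \<in> N" "x = DD #>\<^bsub>G\<^esub> n" using x by (auto simp: carrier_ab)
  have kG: "k \<in> carrier G" "n \<in> carrier G" using k n(1) by auto
  have "k \<otimes>\<^bsub>G\<^esub> n \<otimes>\<^bsub>G\<^esub> inv\<^bsub>G\<^esub> k \<otimes>\<^bsub>G\<^esub> inv\<^bsub>G\<^esub> n \<in> DD"
    unfolding derived_def by (rule generate.incl) (use k n(1) in blast)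
  moreover have "k \<otimes>\<^bsub>G\<^esub> n \<otimes>\<^bsub>G\<^esub> inv\<^bsub>G\<^esub> k \<otimes>\<^bsub>G\<^esub> inv\<^bsub>G\<^esub> n \<otimes>\<^bsub>G\<^esub> n = k \<otimes>\<^bsub>G\<^esub> n \<otimes>\<^bsub>G\<^esub> inv\<^bsub>G\<^esub> k"
    using kG by (simp add: G.m_assoc)
  ultimately have "k \<otimes>\<^bsub>G\<^esub> n \<otimes>\<^bsub>G\<^esub> inv\<^bsub>G\<^esub> k \<in> DD #>\<^bsub>G\<^esub> n" by (force simp: r_coset_def)
  then have "DD #>\<^bsub>G\<^esub> n = DD #>\<^bsub>G\<^esub> (k \<otimes>\<^bsub>G\<^esub> n \<otimes>\<^bsub>G\<^esub> inv\<^bsub>G\<^esub> k)"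
    by (rule G.repr_independence[OF _ kG(2) D.subgroup_axioms])
  then show ?thesis unfolding n(2) conj_coset_rcos[OF kG(1) n(1)] by simp
qed

lemma conj_coset_eq:
  assumes g: "g \<in> carrier G" and h: "h \<in> carrier G" and e: "\<pi> g = \<pi> h" and x: "x \<in> carrier (abelianization NG)"
  shows "conj_coset G g x = conj_coset G h x"
proof -
  have "inv\<^bsub>G\<^esub> h \<otimes>\<^bsub>G\<^esub> g \<in> kernel G Q \<pi>" using g h e by (simp add: kernel_def)
  then have k: "inv\<^bsub>G\<^esub> h \<otimes>\<^bsub>G\<^esub> g \<in> N" using extension by (simp add: group_extension_def)
  have "g = h \<otimes>\<^bsub>G\<^esub> (inv\<^bsub>G\<^esub> h \<otimes>\<^bsub>G\<^esub> g)" using g h by (simp add: G.m_assoc[symmetric])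
  then have "conj_coset G g x = conj_coset G h (conj_coset G (inv\<^bsub>G\<^esub> h \<otimes>\<^bsub>G\<^esub> g) x)"
    using conj_coset_comp[OF h _ x] g h by (metis G.inv_closed G.m_closed)
  then show ?thesis using conj_coset_N[OF k x] by simp
qed

lemma conj_rep_lift:
  assumes g: "g \<in> carrier G"
  shows "conj_rep N G \<pi> (\<pi> g) = tensor_endo (abelianization NG) (add_monoid rat_field) (conj_coset G g) id"
proof -
  have p: "inv_into (carrier G) \<pi> (\<pi> g) \<in> carrier G" "\<pi> (inv_into (carrier G) \<pi> (\<pi> g)) = \<pi> g"
    using g by (auto intro: inv_into_into f_inv_into_f)
  show ?thesis unfolding conj_rep_def Let_def
    by (rule tensor_endo_cong[OF comm_group.axioms(2)[OF abgroup] rat_add_group conj_coset_hom[OF p(1)] id_hom conj_coset_hom[OF g] id_hom])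
      (simp_all add: conj_coset_eq[OF p(1) g p(2)])
qed

theorem linear_representation_conj_rep:
  "linear_representation Q rat_field (rationalization (abelianization NG)) (conj_rep N G \<pi>)"
proof (rule linear_representation.intro)
  let ?A = "abelianization NG" and ?Q = "add_monoid rat_field"
  let ?V = "rationalization ?A"
  note ab = comm_group.axioms(2)[OF abgroup]
  show "group Q" ..
  show "vectorspace rat_field ?V" by (rule vectorspace_rationalization[OF ab])
  have surj: "\<pi> ` carrier G = carrier Q" using extension by (simp add: group_extension_def epi_def)
  have s: "carrier ?V = carrier (tensor_group ?A ?Q)" "x \<oplus>\<^bsub>?V\<^esub> y = x \<otimes>\<^bsub>tensor_group ?A ?Q\<^esub> y"
    "c \<odot>\<^bsub>?V\<^esub> x = tensor_endo ?A ?Q id (\<lambda>r. c * r) x" for x y c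
    by (simp_all add: rationalization_def)
  define \<rho> where "\<rho> g = tensor_endo ?A ?Q (conj_coset G g) id" for g
  have hom: "\<rho> g \<in> hom (tensor_group ?A ?Q) (tensor_group ?A ?Q)" if "g \<in> carrier G" for g
    unfolding \<rho>_def by (rule tensor_endo_hom[OF ab rat_add_group conj_coset_hom[OF that] id_hom])
  have comp: "\<rho> (g \<otimes>\<^bsub>G\<^esub> h) x = \<rho> g (\<rho> h x)" if gh: "g \<in> carrier G" "h \<in> carrier G" and x: "x \<in> carrier ?V" for g h x
  proof -
    have "\<rho> (g \<otimes>\<^bsub>G\<^esub> h) = tensor_endo ?A ?Q (conj_coset G g \<circ> conj_coset G h) (id \<circ> id)"
      unfolding \<rho>_def
      by (rule tensor_endo_cong[OF ab rat_add_group]) 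
        (use gh in \<open>simp_all add: conj_coset_comp conj_coset_hom id_hom hom_compose[OF id_hom id_hom] hom_compose[OF conj_coset_hom conj_coset_hom] del: id_o o_id\<close>)
    then show ?thesis unfolding \<rho>_def
      using tensor_endo_comp[OF ab rat_add_group conj_coset_hom[OF gh(1)] id_hom conj_coset_hom[OF gh(2)] id_hom] x
      by (simp add: s)
  qed
  have one: "\<rho> \<one>\<^bsub>G\<^esub> x = x" if x: "x \<in> carrier ?V" for x
  proof -
    have "\<rho> \<one>\<^bsub>G\<^esub> = tensor_endo ?A ?Q id id"
      unfolding \<rho>_def
      by (rule tensor_endo_cong[OF ab rat_add_group conj_coset_hom[OF G.one_closed] id_hom id_hom id_hom]) 
        (simp_all add: conj_coset_N N.one_closed)
    then show ?thesis using tensor_endo_id[OF ab rat_add_group] x by (simp add: s)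
  qed
  have cl: "\<rho> g x \<in> carrier ?V" if "g \<in> carrier G" "x \<in> carrier ?V" for g x
    using hom_in_carrier[OF hom[OF that(1)]] that(2) by (simp add: s)
  have bij: "\<rho> g \<in> Bij (carrier ?V)" if g: "g \<in> carrier G" for g
  proof -
    have "bij_betw (\<rho> g) (carrier ?V) (carrier ?V)"
    proof (rule bij_betw_byWitness[where f' = "\<rho> (inv\<^bsub>G\<^esub> g)"])
      show "\<forall>a\<in>carrier ?V. \<rho> (inv\<^bsub>G\<^esub> g) (\<rho> g a) = a"
        using comp[of "inv\<^bsub>G\<^esub> g" g] g one by simp
      show "\<forall>a\<in>carrier ?V. \<rho> g (\<rho> (inv\<^bsub>G\<^esub> g) a) = a"
        using comp[of g "inv\<^bsub>G\<^esub> g"] g one by simp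
    qed (use cl g in auto)
    then show ?thesis unfolding Bij_def by (simp add: \<rho>_def s tensor_endo_def)
  qed
  have lin: "\<rho> g \<in> module_hom rat_field ?V ?V" if g: "g \<in> carrier G" for g
  proof -
    have "\<rho> g (tensor_endo ?A ?Q id ((*) c) x) = tensor_endo ?A ?Q id ((*) c) (\<rho> g x)"
      if "x \<in> carrier (tensor_group ?A ?Q)" for c x
      unfolding \<rho>_def
        tensor_endo_comp[OF ab rat_add_group conj_coset_hom[OF g] id_hom id_hom rat_mult_hom that]
        tensor_endo_comp[OF ab rat_add_group id_hom rat_mult_hom conj_coset_hom[OF g] id_hom that]
      by (simp only: id_comp comp_id)
    then show ?thesis
      using hom_mult[OF hom[OF g]] cl[OF g] by (auto simp: module_hom_def s)
  qed
  have eq: "conj_rep N G \<pi> (\<pi> g) = \<rho> g" if "g \<in> carrier G" for g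
    unfolding \<rho>_def by (rule conj_rep_lift[OF that])
  show "conj_rep N G \<pi> \<in> hom Q (general_linear_group rat_field ?V)"
  proof (rule homI)
    fix q assume "q \<in> carrier Q"
    then obtain g where g: "g \<in> carrier G" "q = \<pi> g" using surj by auto
    then show "conj_rep N G \<pi> q \<in> carrier (general_linear_group rat_field ?V)"
      using bij lin by (simp add: eq general_linear_group_def)
  next
    fix q r assume "q \<in> carrier Q" "r \<in> carrier Q"
    then obtain g h where g: "g \<in> carrier G" "q = \<pi> g" and h: "h \<in> carrier G" "r = \<pi> h" using surj by (metis imageE)
    have "conj_rep N G \<pi> (q \<otimes>\<^bsub>Q\<^esub> r) = \<rho> (g \<otimes>\<^bsub>G\<^esub> h)"
      using eq[of "g \<otimes>\<^bsub>G\<^esub> h"] g h by simp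
    also have "\<dots> = compose (carrier ?V) (\<rho> g) (\<rho> h)"
      using Bij_imp_extensional[OF bij] g h comp
      by (intro extensionalityI[of _ "carrier ?V"]) (auto simp: compose_def)
    finally show "conj_rep N G \<pi> (q \<otimes>\<^bsub>Q\<^esub> r) =
      conj_rep N G \<pi> q \<otimes>\<^bsub>general_linear_group rat_field ?V\<^esub> conj_rep N G \<pi> r"
      using g h bij by (simp add: general_linear_group_def BijGroup_def eq)
  qed
qed

end

end

theory Submission
  imports Defs
begin

text \<open>Suppose that some finite subset of \<open>L\<close> is injected by no orbit map. Then every point
  stabilizer in \<open>N\<close> contains one of finitely many elements of \<open>N\<close> that have infinite order in
  \<open>N\<^sup>a\<^sup>b\<close>. Hence finitely many subgroups of \<open>N\<close>, each with non-zero rational span in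
  \<open>N\<^sup>a\<^sup>b \<otimes> \<rat>\<close>, are such that every stabilizer contains one of them. If this finite family is chosen
  with the smallest occurring dimension of the spans as large as possible, and then with as few
  spans of that dimension as possible, then \<open>G\<close> permutes those spans, because the set of stabilizers
  is invariant under conjugation. By strong irreducibility all the subgroups
  have full rational span. In a nilpotent group such a subgroup contains a positive power of
  every element, so one element of infinite order has a power in all stabilizers,
  against faithfulness.\<close>

section \<open>Subgroups of nilpotent groups with torsion cokernel on the abelianization\<close>

text \<open>The point stabilizers in \<open>N\<close> may form an infinite family, so their spans
  offer no finite set of subspaces permuted by \<open>G\<close>. The finite families of subgroups
  are lower bounds for them, and the extremal choice makes the spans of least rank canonical: a
  family joined with its conjugate by an element g again lies below the stabilizers, since the
  stabilizer of x contains the g-conjugate of whatever fixes g^-1 x. Joins only enlarge spans, so a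
  join of least rank has the span of both of its parts. As these spans are merely permuted, only
  their union is known to be preserved, which is what strong irreducibility addresses. It makes the
  whole space one of the spans of least rank, and this is why the remaining members have full span
  too. Nilpotency serves to return from N^ab to \<open>N\<close>: modulo the next term of the lower
  central series commutators are bilinear, so a torsion cokernel on N^ab propagates to every lower
  central quotient.\<close>

definition commutator :: "('a, 'm) monoid_scheme \<Rightarrow> 'a \<Rightarrow> 'a \<Rightarrow> 'a"
  where "commutator G x y = x \<otimes>\<^bsub>G\<^esub> y \<otimes>\<^bsub>G\<^esub> inv\<^bsub>G\<^esub> x \<otimes>\<^bsub>G\<^esub> inv\<^bsub>G\<^esub> y"

context group
begin

lemma inv_cancel_left:
  assumes "x \<in> carrier G" "y \<in> carrier G"
  shows "inv x \<otimes> (x \<otimes> y) = y" "x \<otimes> (inv x \<otimes> y) = y"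
  using assms by (simp_all add: m_assoc[symmetric])

lemma commutator_closed [simp, intro]:
  "x \<in> carrier G \<Longrightarrow> y \<in> carrier G \<Longrightarrow> commutator G x y \<in> carrier G"
  by (simp add: commutator_def)

lemma inv_commutator:
  "x \<in> carrier G \<Longrightarrow> y \<in> carrier G \<Longrightarrow> inv (commutator G x y) = commutator G y x"
  by (simp add: commutator_def inv_mult_group m_assoc)

text \<open>This is u [v,y] u^-1 times [u,y], with the conjugate written as a commutator times
  [v,y]. In this form the only obstruction to multiplicativity, apart from the order of the factors,
  is [u,[v,y]], which dies in every quotient where [v,y] is central.\<close>

lemma commutator_mult_left:
  assumes "u \<in> carrier G" "v \<in> carrier G" "y \<in> carrier G"
  shows "commutator G (u \<otimes> v) y =
    commutator G u (commutator G v y) \<otimes> commutator G v y \<otimes> commutator G u y"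
  using assms by (simp add: commutator_def inv_mult_group m_assoc inv_cancel_left)

lemma commutator_swap_mult:
  assumes "x \<in> carrier G" "y \<in> carrier G"
  shows "commutator G x y \<otimes> (y \<otimes> x) = x \<otimes> y"
  using assms by (simp add: commutator_def m_assoc inv_cancel_left)

lemma conj_eq_commutator_mult:
  assumes "x \<in> carrier G" "y \<in> carrier G"
  shows "x \<otimes> y \<otimes> inv x = commutator G x y \<otimes> y"
  using assms by (simp add: commutator_def m_assoc)

end

lemma (in normal) rcos_eq_one_iff: "x \<in> carrier G \<Longrightarrow> H #> x = H \<longleftrightarrow> x \<in> H"
  using coset_join1 coset_join2 subgroup_axioms subset by blast

lemma (in normal) rcos_eq_iff:
  assumes "x \<in> carrier G" "y \<in> carrier G"
  shows "H #> x = H #> y \<longleftrightarrow> (\<exists>c\<in>H. x = c \<otimes> y)"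
proof
  assume "H #> x = H #> y"
  then have "x \<in> H #> y" using rcos_self[OF assms(1) subgroup_axioms] by simp
  then show "\<exists>c\<in>H. x = c \<otimes> y" by (auto simp: r_coset_def)
next
  assume "\<exists>c\<in>H. x = c \<otimes> y"
  then have "x \<in> H #> y" by (auto simp: r_coset_def)
  then show "H #> x = H #> y" using repr_independence[OF _ assms(2) subgroup_axioms] by simp
qed

lemma (in normal) group_hom_Mod: "group_hom G (G Mod H) (\<lambda>x. H #> x)"
  by (intro group_hom.intro group_hom_axioms.intro is_group factorgroup_is_group r_coset_hom_Mod)

lemma (in normal) rcos_commute_iff:
  assumes "x \<in> carrier G" "y \<in> carrier G"
  shows "(H #> x) <#> (H #> y) = (H #> y) <#> (H #> x) \<longleftrightarrow> commutator G x y \<in> H"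
proof -
  have "(H #> x) <#> (H #> y) = (H #> y) <#> (H #> x) \<longleftrightarrow> (\<exists>c\<in>H. x \<otimes> y = c \<otimes> (y \<otimes> x))"
    using assms by (simp add: rcos_sum rcos_eq_iff)
  also have "\<dots> \<longleftrightarrow> commutator G x y \<in> H"
  proof
    assume "\<exists>c\<in>H. x \<otimes> y = c \<otimes> (y \<otimes> x)"
    then obtain c where c: "c \<in> H" "x \<otimes> y = c \<otimes> (y \<otimes> x)" by blast
    have "commutator G x y \<otimes> (y \<otimes> x) = c \<otimes> (y \<otimes> x)"
      using assms c by (simp add: commutator_swap_mult)
    then have "commutator G x y = c" using assms c(1) by simp
    then show "commutator G x y \<in> H" using c(1) by simp
  next
    assume "commutator G x y \<in> H"
    then show "\<exists>c\<in>H. x \<otimes> y = c \<otimes> (y \<otimes> x)" using commutator_swap_mult[OF assms] by metis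
  qed
  finally show ?thesis .
qed

text \<open>\<open>u \<mapsto> Y [u, y]\<close> is a homomorphism from \<open>K\<close> to the central, torsion-free
  subgroup \<open>\<Gamma>/Y\<close> of \<open>G/Y\<close>.\<close>

locale central_commutator = group +
  fixes Y \<Gamma> K y
  assumes normal: "Y \<lhd> G" and subgroups: "subgroup \<Gamma> G" "subgroup K G"
    and y: "y \<in> carrier G"
    and commutator_K: "u \<in> K \<Longrightarrow> commutator G u y \<in> \<Gamma>"
    and central: "g \<in> carrier G \<Longrightarrow> w \<in> \<Gamma> \<Longrightarrow> commutator G g w \<in> Y"
    and isolated: "w \<in> \<Gamma> \<Longrightarrow> 0 < (k::nat) \<Longrightarrow> w [^] k \<in> Y \<Longrightarrow> w \<in> Y"
begin

interpretation Y: normal Y G by (rule normal)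
interpretation YH: group_hom G "G Mod Y" "\<lambda>x. Y #> x" by (rule Y.group_hom_Mod)
interpretation K: subgroup K G by (rule subgroups)
interpretation \<Gamma>: subgroup \<Gamma> G by (rule subgroups)

text \<open>Both defects in \<open>commutator_mult_left\<close> vanish modulo \<open>Y\<close>:
  [u,[v,y]] lies in \<open>Y\<close>, and the reversed factors commute because \<Gamma> is central
  modulo \<open>Y\<close>.\<close>

lemma commutator_hom: "group_hom (G\<lparr>carrier := K\<rparr>) (G Mod Y) (\<lambda>u. Y #> commutator G u y)"
proof (intro group_hom.intro group_hom_axioms.intro homI)
  show "group (G\<lparr>carrier := K\<rparr>)" by (rule subgroup_imp_group[OF subgroups(2)])
  show "group (G Mod Y)" by (rule Y.factorgroup_is_group)
  fix u v assume "u \<in> carrier (G\<lparr>carrier := K\<rparr>)" "v \<in> carrier (G\<lparr>carrier := K\<rparr>)"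
  then have u: "u \<in> K" "v \<in> K" by auto
  then have uG: "u \<in> carrier G" "v \<in> carrier G" by auto
  have c: "commutator G u y \<in> \<Gamma>" "commutator G v y \<in> \<Gamma>" using commutator_K u by auto
  have "commutator G u (commutator G v y) \<in> Y" by (rule central[OF uG(1) c(2)])
  then have e: "Y #> commutator G u (commutator G v y) = Y"
    using uG y by (simp add: Y.rcos_eq_one_iff)
  have "Y #> commutator G (u \<otimes> v) y =
    (Y #> commutator G u (commutator G v y)) <#> (Y #> commutator G v y) <#> (Y #> commutator G u y)"
    by (simp only: commutator_mult_left[OF uG y] Y.rcos_sum m_closed commutator_closed uG y)
  also have "\<dots> = (Y #> commutator G v y) <#> (Y #> commutator G u y)"
    unfolding e by (subst Y.rcosets_mult_eq) (simp_all add: rcosetsI[OF Y.subset] uG y)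
  also have "\<dots> = (Y #> commutator G u y) <#> (Y #> commutator G v y)"
    using central[OF _ c(1), of "commutator G v y"] uG y by (simp add: Y.rcos_commute_iff)
  finally show "Y #> commutator G (u \<otimes>\<^bsub>G\<lparr>carrier := K\<rparr>\<^esub> v) y =
    (Y #> commutator G u y) \<otimes>\<^bsub>G Mod Y\<^esub> (Y #> commutator G v y)" by simp
qed (use y in \<open>auto simp: carrier_FactGroup\<close>)

interpretation C: group_hom "G\<lparr>carrier := K\<rparr>" "G Mod Y" "\<lambda>u. Y #> commutator G u y"
  by (rule commutator_hom)

lemma subgroup_centralizer: "subgroup {u \<in> K. commutator G u y \<in> Y} G"
proof -
  have "kernel (G\<lparr>carrier := K\<rparr>) (G Mod Y) (\<lambda>u. Y #> commutator G u y) =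
    {u \<in> K. commutator G u y \<in> Y}"
    unfolding kernel_def
    by (rule Collect_cong, rule conj_cong)
      (simp_all add: Y.rcos_eq_one_iff[OF commutator_closed[OF K.mem_carrier y]])
  then show ?thesis
    using incl_subgroup[OF subgroups(2) C.subgroup_kernel] by (simp only:)
qed

text \<open>Modulo \<open>Y\<close> the commutator of \<open>u [^] k\<close> with \<open>y\<close>
  is the k-th power of [u,y], and \<open>isolated\<close> extracts the root.\<close>

lemma centralizer_isolated:
  assumes u: "u \<in> K" and k: "0 < (k::nat)" "commutator G (u [^] k) y \<in> Y"
  shows "commutator G u y \<in> Y"
proof (rule isolated[OF commutator_K[OF u] k(1)])
  have "Y #> (commutator G u y [^] k) = Y #> commutator G (u [^] k) y"
    using C.hom_nat_pow[of u k] YH.hom_nat_pow[of "commutator G u y" k] u y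
    by (simp add: nat_pow_consistent[symmetric])
  also have "\<dots> = Y" using k(2) u y by (simp add: Y.rcos_eq_one_iff)
  finally show "commutator G u y [^] k \<in> Y" using u y by (simp add: Y.rcos_eq_one_iff)
qed

text \<open>The homomorphism \<open>commutator_hom\<close> has values in a central subgroup of
  \<open>G Mod Y\<close>, so it kills the commutators of \<open>K\<close>.\<close>

lemma derived_in_centralizer: "derived G K \<subseteq> {u \<in> K. commutator G u y \<in> Y}"
  unfolding derived_def
proof (rule generate_subgroup_incl[OF _ subgroup_centralizer], intro subsetI)
  fix c assume "c \<in> derived_set G K"
  then obtain u v where u: "u \<in> K" "v \<in> K" "c = u \<otimes> v \<otimes> inv u \<otimes> inv v" by blast
  let ?f = "\<lambda>u. Y #> commutator G u y"
  have cl: "?f u \<in> carrier (G Mod Y)" "?f v \<in> carrier (G Mod Y)" using u y by (auto simp: carrier_FactGroup)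
  have comm: "?f u \<otimes>\<^bsub>G Mod Y\<^esub> ?f v = ?f v \<otimes>\<^bsub>G Mod Y\<^esub> ?f u"
    using central[OF _ commutator_K[OF u(2)], of "commutator G u y"] u y by (simp add: Y.rcos_commute_iff)
  have i: "inv\<^bsub>G\<lparr>carrier := K\<rparr>\<^esub> u = inv u" "inv\<^bsub>G\<lparr>carrier := K\<rparr>\<^esub> v = inv v"
    using m_inv_consistent[OF subgroups(2)] u by auto
  have "?f c = ?f u \<otimes>\<^bsub>G Mod Y\<^esub> ?f v \<otimes>\<^bsub>G Mod Y\<^esub> inv\<^bsub>G Mod Y\<^esub> ?f u \<otimes>\<^bsub>G Mod Y\<^esub> inv\<^bsub>G Mod Y\<^esub> ?f v"
    using C.hom_mult[of "u \<otimes> v \<otimes> inv u" "inv v"] C.hom_mult[of "u \<otimes> v" "inv u"] C.hom_mult[of u v]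
      C.hom_inv[of u] C.hom_inv[of v] u unfolding i by simp
  also have "\<dots> = \<one>\<^bsub>G Mod Y\<^esub>" unfolding comm
    using cl by (metis YH.H.inv_closed YH.H.m_assoc YH.H.m_closed YH.H.r_inv YH.H.r_one)
  finally have "commutator G c y \<in> Y" using u y by (simp add: Y.rcos_eq_one_iff)
  then show "c \<in> {u \<in> K. commutator G u y \<in> Y}" using u by simp
qed

end

section \<open>The lower central series\<close>

context group
begin

lemma subgroup_nat_pow_closed: "subgroup S G \<Longrightarrow> x \<in> S \<Longrightarrow> x [^] (k::nat) \<in> S"
  using subgroup_int_pow_closed[of S x "int k"] by (simp add: int_pow_int)

lemma mixed_commutator_altdef:
  "mixed_commutator G H K = generate G {commutator G h k | h k. h \<in> H \<and> k \<in> K}"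
  by (simp add: mixed_commutator_def commutator_def)

lemma conj_mult:
  "g \<in> carrier G \<Longrightarrow> x \<in> carrier G \<Longrightarrow> y \<in> carrier G \<Longrightarrow>
    g \<otimes> (x \<otimes> y) \<otimes> inv g = (g \<otimes> x \<otimes> inv g) \<otimes> (g \<otimes> y \<otimes> inv g)"
  by (simp add: m_assoc inv_cancel_left)

lemma conj_commutator:
  "g \<in> carrier G \<Longrightarrow> x \<in> carrier G \<Longrightarrow> y \<in> carrier G \<Longrightarrow>
    g \<otimes> commutator G x y \<otimes> inv g = commutator G (g \<otimes> x \<otimes> inv g) (g \<otimes> y \<otimes> inv g)"
  by (simp add: commutator_def inv_mult_group m_assoc inv_cancel_left)

lemma lower_central_normal: "lower_central G j \<lhd> G"
proof (induction j)
  case 0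
  then show ?case using normal_self by simp
next
  case (Suc j)
  interpret L: normal "lower_central G j" G by (rule Suc)
  show ?case unfolding lower_central.simps mixed_commutator_altdef
  proof (rule normal_generateI)
    fix h g assume "h \<in> {commutator G h k |h k. h \<in> carrier G \<and> k \<in> lower_central G j}"
      and g: "g \<in> carrier G"
    then obtain x k where x: "h = commutator G x k" "x \<in> carrier G" "k \<in> lower_central G j" by blast
    then have "g \<otimes> h \<otimes> inv g = commutator G (g \<otimes> x \<otimes> inv g) (g \<otimes> k \<otimes> inv g)"
      using g by (simp add: conj_commutator)
    then show "g \<otimes> h \<otimes> inv g \<in> {commutator G h k |h k. h \<in> carrier G \<and> k \<in> lower_central G j}"
      using L.inv_op_closed2[OF g x(3)] g x(2) by blast
  qed auto
qed

lemma commutator_in_lower_central: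
  assumes "n \<in> carrier G" "a \<in> lower_central G j"
  shows "commutator G n a \<in> lower_central G (Suc j)"
  using assms by (auto simp: mixed_commutator_altdef intro: generate.incl)

lemma lower_central_Suc_le: "lower_central G (Suc j) \<subseteq> lower_central G j"
proof -
  interpret L: normal "lower_central G j" G by (rule lower_central_normal)
  show ?thesis unfolding lower_central.simps mixed_commutator_altdef
  proof (rule generate_subgroup_incl[OF _ L.subgroup_axioms], clarify)
    fix h k assume h: "h \<in> carrier G" and k: "k \<in> lower_central G j"
    have "commutator G h k = (h \<otimes> k \<otimes> inv h) \<otimes> inv k" by (simp add: commutator_def)
    then show "commutator G h k \<in> lower_central G j"
      using L.inv_op_closed2[OF h k] k by (simp add: L.m_closed)
  qed
qed

lemma lower_central_1: "lower_central G (Suc 0) = derived G (carrier G)"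
  unfolding lower_central.simps mixed_commutator_def derived_def
  by (rule arg_cong[of _ _ "generate G"]) blast

end

text \<open>For normal \<open>M\<close> and a subgroup \<open>H\<close> this is membership in the
  isolator of the subgroup \<open>M H\<close>. The formulation with cosets lets exponents be
  computed in \<open>G Mod M\<close>.\<close>

definition power_rel :: "('a, 'm) monoid_scheme \<Rightarrow> 'a set \<Rightarrow> 'a set \<Rightarrow> 'a \<Rightarrow> bool"
  where "power_rel G M H x \<longleftrightarrow> (\<exists>k::nat. 0 < k \<and> (\<exists>h\<in>H. M #>\<^bsub>G\<^esub> (x [^]\<^bsub>G\<^esub> k) = M #>\<^bsub>G\<^esub> h))"

context normal
begin

interpretation p: group_hom G "G Mod H" "\<lambda>x. H #> x" by (rule group_hom_Mod)

lemma power_relI: "0 < (k::nat) \<Longrightarrow> h \<in> S \<Longrightarrow> H #> (x [^] k) = H #> h \<Longrightarrow> power_rel G H S x"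
  unfolding power_rel_def by blast

text \<open>Isolators need not be closed under products in general. Here the classes of
  \<open>x\<close> and \<open>y\<close> commute, so exponents \<open>k\<close> and \<open>l\<close>
  for them give the exponent \<open>k * l\<close> for the product.\<close>

lemma power_rel_mult:
  assumes S: "subgroup S G" and x: "x \<in> carrier G" and y: "y \<in> carrier G"
    and c: "commutator G x y \<in> H"
    and px: "power_rel G H S x" and py: "power_rel G H S y"
  shows "power_rel G H S (x \<otimes> y)"
proof -
  interpret S: subgroup S G by (rule S)
  obtain k h where k: "0 < (k::nat)" "h \<in> S" "H #> (x [^] k) = H #> h" using px unfolding power_rel_def by blast
  obtain l i where l: "0 < (l::nat)" "i \<in> S" "H #> (y [^] l) = H #> i" using py unfolding power_rel_def by blast
  have hi: "h \<in> carrier G" "i \<in> carrier G" using k l by auto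
  let ?p = "\<lambda>x. H #> x"
  have "?p ((x \<otimes> y) [^] (k * l)) = (?p x \<otimes>\<^bsub>G Mod H\<^esub> ?p y) [^]\<^bsub>G Mod H\<^esub> (k * l)"
    by (simp only: p.hom_nat_pow p.hom_mult x y m_closed)
  also have "\<dots> = ?p x [^]\<^bsub>G Mod H\<^esub> (k * l) \<otimes>\<^bsub>G Mod H\<^esub> ?p y [^]\<^bsub>G Mod H\<^esub> (k * l)"
    by (rule p.H.pow_mult_distrib) (use x y c in \<open>simp_all add: rcos_commute_iff carrier_FactGroup\<close>)
  also have "?p x [^]\<^bsub>G Mod H\<^esub> (k * l) = ?p ((x [^] k) [^] l)"
    using x by (simp only: p.hom_nat_pow nat_pow_pow nat_pow_closed)
  also have "\<dots> = ?p (h [^] l)"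
    using x hi k(3) by (simp only: p.hom_nat_pow nat_pow_closed)
  also have "?p y [^]\<^bsub>G Mod H\<^esub> (k * l) = ?p ((y [^] l) [^] k)"
    using y by (simp only: p.hom_nat_pow nat_pow_pow nat_pow_closed mult.commute)
  also have "\<dots> = ?p (i [^] k)"
    using y hi l(3) by (simp only: p.hom_nat_pow nat_pow_closed)
  also have "?p (h [^] l) \<otimes>\<^bsub>G Mod H\<^esub> ?p (i [^] k) = ?p (h [^] l \<otimes> i [^] k)"
    using hi by (simp only: p.hom_mult nat_pow_closed)
  finally have "?p ((x \<otimes> y) [^] (k * l)) = ?p (h [^] l \<otimes> i [^] k)" .
  moreover have "h [^] l \<otimes> i [^] k \<in> S"
    using k(2) l(2) S.m_closed subgroup_nat_pow_closed[OF S] by simp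
  ultimately show ?thesis using k(1) l(1) by (intro power_relI[of "k * l"]) auto
qed

lemma power_rel_power:
  assumes x: "x \<in> carrier G" and k: "0 < (k::nat)" and p: "power_rel G H S (x [^] k)"
  shows "power_rel G H S x"
proof -
  obtain l h where l: "0 < (l::nat)" "h \<in> S" "H #> ((x [^] k) [^] l) = H #> h" using p unfolding power_rel_def by blast
  then show ?thesis using k x by (intro power_relI[of "k * l" h]) (auto simp: nat_pow_pow)
qed

lemma power_rel_inv:
  assumes S: "subgroup S G" and x: "x \<in> carrier G" and p: "power_rel G H S x"
  shows "power_rel G H S (inv x)"
proof -
  interpret S: subgroup S G by (rule S)
  obtain k h where k: "0 < (k::nat)" "h \<in> S" "H #> (x [^] k) = H #> h" using p unfolding power_rel_def by blast
  have "H #> (inv x [^] k) = H #> inv h"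
    using k x by (metis S.mem_carrier nat_pow_inv nat_pow_closed p.hom_inv)
  then show ?thesis using k by (intro power_relI[of k "inv h"]) auto
qed

lemma power_rel_base: "x \<in> carrier G \<Longrightarrow> x \<in> S \<Longrightarrow> power_rel G H S x"
  by (rule power_relI[of 1 x]) auto

lemma power_rel_kernel:
  assumes "subgroup S G" "x \<in> H"
  shows "power_rel G H S x"
proof -
  have "x \<in> carrier G" using assms(2) by simp
  then show ?thesis using assms subgroup.one_closed[OF assms(1)]
    by (intro power_relI[of 1 \<one>]) (auto simp: rcos_eq_one_iff)
qed

end

context group
begin

text \<open>The term at level \<open>Suc j\<close> is generated by commutators [n,a] with
  \<open>a\<close> at level \<open>j\<close>, and these are bilinear modulo the next term. Powers of
  \<open>n\<close> and of \<open>a\<close> come from \<open>H\<close> up to factors that do not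
  affect the commutator, hence so does a power of [n,a]. Bilinearity is exploited one variable at a
  time through \<open>central_commutator\<close>.\<close>

lemma power_rel_lower_central:
  assumes H: "subgroup H G"
    and hyp: "\<And>x. x \<in> carrier G \<Longrightarrow> power_rel G (derived G (carrier G)) H x"
  shows "a \<in> lower_central G j \<Longrightarrow>
    power_rel G (lower_central G (Suc j)) (H \<inter> lower_central G j) a"
proof (induction j arbitrary: a)
  case 0
  then show ?case using hyp subgroup.subset[OF H] unfolding lower_central_1 by (simp add: Int_absorb2)
next
  case (Suc j)
  let ?L = "lower_central G"
  interpret L0: normal "?L j" G by (rule lower_central_normal)
  interpret L1: normal "?L (Suc j)" G by (rule lower_central_normal)
  interpret L2: normal "?L (Suc (Suc j))" G by (rule lower_central_normal)
  interpret H: subgroup H G by (rule H)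
  have S: "subgroup (H \<inter> ?L (Suc j)) G" by (rule subgroups_Inter_pair[OF H L1.subgroup_axioms])
  have L10: "?L (Suc j) \<subseteq> ?L j" by (rule lower_central_Suc_le)
  have L21: "?L (Suc (Suc j)) \<subseteq> ?L (Suc j)" by (rule lower_central_Suc_le)
  let ?rel = "power_rel G (?L (Suc (Suc j))) (H \<inter> ?L (Suc j))"
  \<comment> \<open>\<open>Y\<close> collects the elements for which the claim holds. It contains
    the next term, so \<open>?L (Suc j)\<close> is central modulo \<open>Y\<close>; it is closed
    under roots taken in \<open>?L (Suc j)\<close>, so the quotient is torsion-free. These are the
    assumptions of \<open>central_commutator\<close>.\<close>
  define Y where "Y = {t \<in> ?L (Suc j). ?rel t}"
  have L1c: "t \<in> ?L (Suc j) \<Longrightarrow> t \<in> carrier G" for t by (rule L1.mem_carrier)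
  have c2: "commutator G g t \<in> ?L (Suc (Suc j))" if "g \<in> carrier G" "t \<in> ?L (Suc j)" for g t
    by (rule commutator_in_lower_central[OF that])
  have L2Y: "?L (Suc (Suc j)) \<subseteq> Y"
    using L21 L2.power_rel_kernel[OF S] unfolding Y_def by blast
  have Ymult: "s \<otimes> t \<in> Y" if "s \<in> Y" "t \<in> Y" for s t
  proof -
    have st: "s \<in> ?L (Suc j)" "t \<in> ?L (Suc j)" "?rel s" "?rel t" using that by (auto simp only: Y_def mem_Collect_eq)
    show ?thesis unfolding Y_def mem_Collect_eq
      using L1.m_closed[OF st(1,2)] L2.power_rel_mult[OF S L1c[OF st(1)] L1c[OF st(2)] c2[OF L1c[OF st(1)] st(2)] st(3,4)] by blast
  qed
  have "subgroup Y G"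
  proof (rule subgroupI)
    show "Y \<subseteq> carrier G" unfolding Y_def using L1c by blast
    show "Y \<noteq> {}" using L2Y L2.one_closed by blast
    fix t assume "t \<in> Y"
    then have t: "t \<in> ?L (Suc j)" "?rel t" by (auto simp only: Y_def mem_Collect_eq)
    show "inv t \<in> Y" unfolding Y_def mem_Collect_eq
      using L1.m_inv_closed[OF t(1)] L2.power_rel_inv[OF S L1c[OF t(1)] t(2)] by blast
  qed (rule Ymult)
  then have normalY: "Y \<lhd> G"
  proof (rule normal_invI)
    fix g t assume g: "g \<in> carrier G" and t: "t \<in> Y"
    then have "t \<in> ?L (Suc j)" by (simp only: Y_def mem_Collect_eq)
    then have "g \<otimes> t \<otimes> inv g = commutator G g t \<otimes> t" "commutator G g t \<in> ?L (Suc (Suc j))"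
      using conj_eq_commutator_mult[OF g L1c] c2[OF g] by blast+
    then show "g \<otimes> t \<otimes> inv g \<in> Y" using Ymult L2Y t by (metis subsetD)
  qed
  have iso: "w \<in> Y" if "w \<in> ?L (Suc j)" "0 < (k::nat)" "w [^] k \<in> Y" for w k
    using L2.power_rel_power[OF L1c[OF that(1)] that(2)] that(1,3) unfolding Y_def by blast
  have cent: "commutator G g w \<in> Y" if "g \<in> carrier G" "w \<in> ?L (Suc j)" for g w
    using c2[OF that] L2Y by blast
  have HY: "w \<in> Y" if "w \<in> H" "w \<in> ?L (Suc j)" for w
    using that L2.power_rel_base[OF L1c, of w "H \<inter> ?L (Suc j)"] unfolding Y_def by blast
  \<comment> \<open>Here \<open>a\<close> lies in \<open>H\<close> and \<open>u\<close> is
    arbitrary. A power of \<open>u\<close> is \<open>d \<otimes> h\<close> with \<open>d\<close> in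
    the derived subgroup, which centralizes \<open>a\<close> modulo \<open>Y\<close>, and [h,a] lies
    in \<open>H\<close>; then the root is extracted.\<close>
  have step1: "commutator G u a \<in> Y" if a: "a \<in> H" "a \<in> ?L j" and u: "u \<in> carrier G" for a u
  proof -
    have aG: "a \<in> carrier G" using a by simp
    interpret c: central_commutator G Y "?L (Suc j)" "carrier G" a
      by (rule central_commutator.intro[OF is_group central_commutator_axioms.intro[OF normalY
            L1.subgroup_axioms subgroup_self aG commutator_in_lower_central[OF _ a(2)] cent iso]])
    obtain k h where k: "0 < (k::nat)" "h \<in> H" "derived G (carrier G) #> (u [^] k) = derived G (carrier G) #> h"
      using hyp[OF u] unfolding power_rel_def by blast
    interpret D: normal "derived G (carrier G)" G by (rule derived_is_normal[OF normal_self])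
    obtain d where d: "d \<in> derived G (carrier G)" "u [^] k = d \<otimes> h"
      using k(3) D.rcos_eq_iff[OF nat_pow_closed[OF u] H.mem_carrier[OF k(2)]] by blast
    have "commutator G h a \<in> Y"
    proof (rule HY)
      show "commutator G h a \<in> H" using k(2) a(1) by (simp add: commutator_def)
      show "commutator G h a \<in> ?L (Suc j)"
        using k(2) a(2) by (intro commutator_in_lower_central) simp
    qed
    then have "d \<otimes> h \<in> {u \<in> carrier G. commutator G u a \<in> Y}"
      using c.derived_in_centralizer d(1) k(2) by (intro subgroup.m_closed[OF c.subgroup_centralizer]) auto
    then have "commutator G (u [^] k) a \<in> Y" using d(2) by simp
    then show ?thesis by (rule c.centralizer_isolated[OF u k(1)])
  qed
  \<comment> \<open>Now \<open>a\<close> leaves \<open>H\<close>. The arguments are swapped because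
    \<open>central_commutator\<close> is linear in the first one. A power of \<open>a\<close> is
    \<open>d \<otimes> h\<close> with \<open>h\<close> covered by \<open>step1\<close> and
    \<open>d\<close> in \<open>?L (Suc j)\<close>, central modulo \<open>Y\<close>.\<close>
  have step2: "commutator G a n \<in> Y" if a: "a \<in> ?L j" and n: "n \<in> carrier G" for a n
  proof -
    have ci: "commutator G a n = inv (commutator G n a)" if "a \<in> ?L j" for a
      using n L0.mem_carrier[OF that] by (simp add: inv_commutator)
    have cl: "commutator G a n \<in> ?L (Suc j)" if "a \<in> ?L j" for a
      unfolding ci[OF that] by (rule L1.m_inv_closed[OF commutator_in_lower_central[OF n that]])
    interpret c: central_commutator G Y "?L (Suc j)" "?L j" n
      by (rule central_commutator.intro[OF is_group central_commutator_axioms.intro[OF normalY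
            L1.subgroup_axioms L0.subgroup_axioms n cl cent iso]])
    have inY: "commutator G a n \<in> Y" if "commutator G n a \<in> Y" "a \<in> ?L j" for a
      unfolding ci[OF that(2)] by (rule subgroup.m_inv_closed[OF \<open>subgroup Y G\<close> that(1)])
    obtain k h where k: "0 < (k::nat)" "h \<in> H \<inter> ?L j" "?L (Suc j) #> (a [^] k) = ?L (Suc j) #> h"
      using Suc.IH[OF a] unfolding power_rel_def by blast
    have aG: "a \<in> carrier G" "h \<in> carrier G" using a k(2) by auto
    obtain d where d: "d \<in> ?L (Suc j)" "a [^] k = d \<otimes> h"
      using k(3) L1.rcos_eq_iff[OF nat_pow_closed[OF aG(1)] aG(2)] by blast
    have "h \<in> {u \<in> ?L j. commutator G u n \<in> Y}" using inY step1 k(2) n by blast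
    moreover have "d \<in> {u \<in> ?L j. commutator G u n \<in> Y}" using inY cent n d(1) L10 by blast
    ultimately have "d \<otimes> h \<in> {u \<in> ?L j. commutator G u n \<in> Y}"
      by (intro subgroup.m_closed[OF c.subgroup_centralizer])
    then have "commutator G (a [^] k) n \<in> Y" using d(2) by simp
    then show ?thesis by (rule c.centralizer_isolated[OF a k(1)])
  qed
  have "?L (Suc j) \<subseteq> Y"
    unfolding lower_central.simps(2)[of G j] mixed_commutator_altdef
  proof (rule generate_subgroup_incl[OF _ \<open>subgroup Y G\<close>], clarify)
    fix n a assume n: "n \<in> carrier G" and a: "a \<in> ?L j"
    have "commutator G n a = inv (commutator G a n)" using n L0.mem_carrier[OF a] by (simp add: inv_commutator)
    then show "commutator G n a \<in> Y"
      using subgroup.m_inv_closed[OF \<open>subgroup Y G\<close> step2[OF a n]] by simp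
  qed
  then show ?case using Suc.prems unfolding Y_def by blast
qed

text \<open>If a power of \<open>x\<close> is \<open>d \<otimes> h\<close> with \<open>d\<close> in
  one term of the series and \<open>h\<close> in \<open>H\<close>, then a power of \<open>d\<close>
  is in \<open>H\<close> modulo the next term, which also contains [d,h]; so a power of the product
  is in \<open>H\<close> modulo that term. The error moves down the series until it is
  trivial.\<close>

theorem nilpotent_power_in_subgroup:
  assumes nil: "nilpotent_group G" and H: "subgroup H G"
    and hyp: "\<And>x. x \<in> carrier G \<Longrightarrow> power_rel G (derived G (carrier G)) H x"
    and x: "x \<in> carrier G"
  obtains k :: nat where "0 < k" "x [^] k \<in> H"
proof -
  let ?L = "lower_central G"
  interpret H: subgroup H G by (rule H)
  have P: "power_rel G (?L (Suc j)) H x" for j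
  proof (induction j)
    case 0
    then show ?case using hyp[OF x] by (simp only: lower_central_1)
  next
    case (Suc j)
    interpret L1: normal "?L (Suc j)" G by (rule lower_central_normal)
    interpret L2: normal "?L (Suc (Suc j))" G by (rule lower_central_normal)
    obtain k h where k: "0 < (k::nat)" "h \<in> H" "?L (Suc j) #> (x [^] k) = ?L (Suc j) #> h"
      using Suc unfolding power_rel_def by blast
    have hG: "h \<in> carrier G" using k(2) by simp
    obtain d where d: "d \<in> ?L (Suc j)" "x [^] k = d \<otimes> h"
      using k(3) L1.rcos_eq_iff[OF nat_pow_closed[OF x] hG] by blast
    have dG: "d \<in> carrier G" by (rule L1.mem_carrier[OF d(1)])
    have "power_rel G (?L (Suc (Suc j))) H d"
      using power_rel_lower_central[OF H hyp d(1)] unfolding power_rel_def by blast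
    moreover have "power_rel G (?L (Suc (Suc j))) H h" by (rule L2.power_rel_base[OF hG k(2)])
    moreover have "commutator G d h \<in> ?L (Suc (Suc j))"
      using L2.m_inv_closed[OF commutator_in_lower_central[OF hG d(1)]] by (simp only: inv_commutator[OF hG dG])
    ultimately have "power_rel G (?L (Suc (Suc j))) H (x [^] k)"
      unfolding d(2) using L2.power_rel_mult[OF H dG hG] by blast
    then show ?case by (rule L2.power_rel_power[OF x k(1)])
  qed
  obtain c where c: "?L c = {\<one>}" using nil unfolding nilpotent_group_def by blast
  interpret L1: normal "?L (Suc c)" G by (rule lower_central_normal)
  \<comment> \<open>\<open>P\<close> is available at indices \<open>Suc j\<close> only, so the
    vanishing term is shifted by one.\<close>
  have c1: "?L (Suc c) = {\<one>}" using lower_central_Suc_le[of c] c L1.one_closed by blast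
  obtain k h where k: "0 < (k::nat)" "h \<in> H" "?L (Suc c) #> (x [^] k) = ?L (Suc c) #> h"
    using P[of c] unfolding power_rel_def by blast
  have "x [^] k = h"
    using k(3) L1.rcos_eq_iff[of "x [^] k" h] x H.mem_carrier[OF k(2)] unfolding c1 by auto
  then show ?thesis using that k by blast
qed

end

section \<open>Tensor products with the rationals\<close>

text \<open>A constant, since the simplifier would rewrite the fields of the record
  \<open>add_monoid rat_field\<close> inside \<open>tensor_group\<close>.\<close>

definition rat_add :: "rat monoid"
  where "rat_add = add_monoid rat_field"

abbreviation rat_tensor :: "('a, 'm) monoid_scheme \<Rightarrow> ('a \<times> rat \<Rightarrow>\<^sub>0 int) set monoid"
  where "rat_tensor A \<equiv> tensor_group A rat_add"

definition pure_tensor :: "('a, 'm) monoid_scheme \<Rightarrow> 'a \<Rightarrow> rat \<Rightarrow> ('a \<times> rat \<Rightarrow>\<^sub>0 int) set"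
  where "pure_tensor A a r =
    tensor_relations A rat_add #>\<^bsub>free_Abelian_group (carrier A \<times> carrier rat_add)\<^esub> frag_of (a, r)"

text \<open>No sums are taken. For a subgroup \<open>U\<close> the set is nevertheless a subspace,
  because two pure tensors add up to a single one over a common denominator.\<close>

definition tensor_span :: "('a, 'm) monoid_scheme \<Rightarrow> 'a set \<Rightarrow> ('a \<times> rat \<Rightarrow>\<^sub>0 int) set set"
  where "tensor_span A U = {pure_tensor A a r | a r. a \<in> U}"

lemma pure_tensor_in_span: "a \<in> U \<Longrightarrow> pure_tensor A a r \<in> tensor_span A U"
  unfolding tensor_span_def by blast

lemma rat_add_simps [simp]:
  "carrier rat_add = UNIV" "x \<otimes>\<^bsub>rat_add\<^esub> y = x + y" "\<one>\<^bsub>rat_add\<^esub> = 0"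
  by (simp_all add: rat_add_def rat_field_simps)

lemma group_rat_add: "group rat_add"
  unfolding rat_add_def by (rule rat_add_group)

lemma mult_hom_rat_add: "(*) c \<in> hom rat_add rat_add"
  by (auto simp: hom_def distrib_left)

lemma rat_add_nat_pow: "r [^]\<^bsub>rat_add\<^esub> (k::nat) = of_nat k * r"
  by (induction k) (simp_all add: algebra_simps del: of_nat_Suc add: of_nat_Suc)

lemma rat_add_inv: "inv\<^bsub>rat_add\<^esub> r = - r"
  by (rule group.inv_equality[OF group_rat_add]) simp_all

lemma rat_add_int_pow: "r [^]\<^bsub>rat_add\<^esub> (k::int) = of_int k * r"
  by (simp add: int_pow_def2 rat_add_nat_pow rat_add_inv)

lemma rat_common_denominator:
  fixes r s :: rat
  obtains p q and m :: nat where "0 < m" "r = of_int p / of_nat m" "s = of_int q / of_nat m"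
proof -
  obtain a b where r: "r = of_int a / of_int b" "b > 0" by (metis quotient_of_div quotient_of_denom_pos surj_pair)
  obtain c d where s: "s = of_int c / of_int d" "d > 0" by (metis quotient_of_div quotient_of_denom_pos surj_pair)
  show ?thesis
  proof (rule that[of "nat (b * d)" "a * d" "c * b"])
    have "of_nat (nat (b * d)) = (of_int b * of_int d :: rat)" using r s by simp
    then show "r = of_int (a * d) / of_nat (nat (b * d))" "s = of_int (c * b) / of_nat (nat (b * d))"
      using r s by simp_all
  qed (use r s in simp)
qed

section \<open>Pure tensors, and torsion as the kernel of the map to the rationalization\<close>

context comm_group
begin

lemma mult_mult_inv_inv:
  "x \<in> carrier G \<Longrightarrow> y \<in> carrier G \<Longrightarrow> x \<otimes> y \<otimes> inv x \<otimes> inv y = \<one>"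
  by (simp add: m_comm[of x y] m_assoc inv_cancel_left)

interpretation Q: group rat_add by (rule group_rat_add)
interpretation F: comm_group "free_Abelian_group (carrier G \<times> carrier rat_add)"
  by (rule abelian_free_Abelian_group)
interpretation T: comm_group "rat_tensor G" by (rule tensor_comm_group[OF is_group group_rat_add])
interpretation R: normal "tensor_relations G rat_add" "free_Abelian_group (carrier G \<times> carrier rat_add)"
  by (rule tensor_relations_normal[OF is_group group_rat_add])

abbreviation (input) "free_pairs \<equiv> free_Abelian_group (carrier G \<times> carrier rat_add)"
abbreviation (input) "tensor_rel \<equiv> tensor_relations G rat_add"

lemma frag_of_carrier: "a \<in> carrier G \<Longrightarrow> frag_of (a, r) \<in> carrier free_pairs"
  by simp

lemma pure_tensor_closed [simp]: "a \<in> carrier G \<Longrightarrow> pure_tensor G a r \<in> carrier (rat_tensor G)"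
  unfolding pure_tensor_def carrier_tensor[OF is_group group_rat_add]
  by (rule imageI) (rule frag_of_carrier)

lemma coset_eqI:
  assumes "x \<in> carrier free_pairs" "y \<in> carrier free_pairs" "x - y \<in> tensor_rel"
  shows "tensor_rel #>\<^bsub>free_pairs\<^esub> x = tensor_rel #>\<^bsub>free_pairs\<^esub> y"
proof -
  have "x = (x - y) \<otimes>\<^bsub>free_pairs\<^esub> y" by simp
  then show ?thesis using R.rcos_eq_iff[OF assms(1,2)] assms(3) by blast
qed

lemma frag_add_carrier: "x \<in> carrier free_pairs \<Longrightarrow> y \<in> carrier free_pairs \<Longrightarrow> x + y \<in> carrier free_pairs"
  using F.m_closed[of x y] by (simp only: mult_free_Abelian_group)

lemma pure_tensor_mult_left:
  assumes a: "a \<in> carrier G" "b \<in> carrier G"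
  shows "pure_tensor G (a \<otimes> b) r = pure_tensor G a r \<otimes>\<^bsub>rat_tensor G\<^esub> pure_tensor G b r"
proof -
  have "frag_of (a \<otimes> b, r) - frag_of (a, r) - frag_of (b, r) \<in> tensor_rel"
    unfolding tensor_relations_def by (rule generate.incl) (use a in auto)
  then show ?thesis
    unfolding pure_tensor_def
      mult_tensor_coset[OF is_group group_rat_add frag_of_carrier[OF a(1)] frag_of_carrier[OF a(2)]]
    by (intro coset_eqI frag_add_carrier frag_of_carrier m_closed a) (simp only: diff_diff_add)
qed

lemma pure_tensor_add_right:
  assumes a: "a \<in> carrier G"
  shows "pure_tensor G a (r + s) = pure_tensor G a r \<otimes>\<^bsub>rat_tensor G\<^esub> pure_tensor G a s"
proof -
  have "frag_of (a, r \<otimes>\<^bsub>rat_add\<^esub> s) - frag_of (a, r) - frag_of (a, s) \<in> tensor_rel"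
    unfolding tensor_relations_def
    by (intro generate.incl UnI2 CollectI exI[of _ a] exI[of _ r] exI[of _ s] conjI refl a)
      simp_all
  then have "frag_of (a, r + s) - (frag_of (a, r) + frag_of (a, s)) \<in> tensor_rel"
    by (simp only: diff_diff_add rat_add_simps)
  then show ?thesis
    unfolding pure_tensor_def
      mult_tensor_coset[OF is_group group_rat_add frag_of_carrier[OF a] frag_of_carrier[OF a]]
    by (intro coset_eqI frag_add_carrier frag_of_carrier a)
qed

lemma pure_tensor_int_pow:
  assumes a: "a \<in> carrier G"
  shows "pure_tensor G (a [^] (k::int)) r = pure_tensor G a (of_int k * r)"
proof -
  have "(\<lambda>a. pure_tensor G a r) \<in> hom G (rat_tensor G)"
    by (rule homI) (simp_all add: pure_tensor_mult_left)
  then have "pure_tensor G (a [^] k) r = pure_tensor G a r [^]\<^bsub>rat_tensor G\<^esub> k"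
    using hom_int_pow[OF _ a is_group T.is_group] by blast
  moreover have "(\<lambda>r. pure_tensor G a r) \<in> hom rat_add (rat_tensor G)"
    by (rule homI) (simp_all add: pure_tensor_add_right a)
  then have "pure_tensor G a (r [^]\<^bsub>rat_add\<^esub> k) = pure_tensor G a r [^]\<^bsub>rat_tensor G\<^esub> k"
    using hom_int_pow[OF _ _ group_rat_add T.is_group, of "\<lambda>r. pure_tensor G a r" r k] by simp
  ultimately show ?thesis by (simp add: rat_add_int_pow)
qed

lemma pure_tensor_one: "pure_tensor G \<one> r = \<one>\<^bsub>rat_tensor G\<^esub>"
  using pure_tensor_mult_left[of \<one> \<one> r] T.l_cancel_one by simp

lemma pure_tensor_inv:
  assumes a: "a \<in> carrier G"
  shows "inv\<^bsub>rat_tensor G\<^esub> pure_tensor G a r = pure_tensor G (inv a) r"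
proof (rule T.inv_equality)
  show "pure_tensor G (inv a) r \<otimes>\<^bsub>rat_tensor G\<^esub> pure_tensor G a r = \<one>\<^bsub>rat_tensor G\<^esub>"
    using pure_tensor_mult_left[of "inv a" a r] a by (simp add: pure_tensor_one)
qed (use a in simp_all)

text \<open>Writing \<open>r\<close> and \<open>s\<close> as p/m and q/m moves the numerators into
  the left factors; both tensors then have right factor 1/m and combine on the left. The explicit
  shape keeps the left factor in any subgroup containing \<open>a\<close> and
  \<open>b\<close>.\<close>

lemma pure_tensor_mult:
  assumes a: "a \<in> carrier G" "b \<in> carrier G"
  obtains p q :: int and t where
    "pure_tensor G a r \<otimes>\<^bsub>rat_tensor G\<^esub> pure_tensor G b s = pure_tensor G (a [^] p \<otimes> b [^] q) t"
proof -
  obtain p q and m :: nat where m: "0 < m" "r = of_int p / of_nat m" "s = of_int q / of_nat m"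
    by (rule rat_common_denominator)
  have "pure_tensor G a r = pure_tensor G (a [^] p) (1 / of_nat m)"
    "pure_tensor G b s = pure_tensor G (b [^] q) (1 / of_nat m)"
    using a m by (simp_all add: pure_tensor_int_pow)
  then show ?thesis using a by (intro that[of p q "1 / of_nat m"]) (simp add: pure_tensor_mult_left)
qed

lemma rat_tensor_carrier: "carrier (rat_tensor G) = tensor_span G (carrier G)"
proof
  show "tensor_span G (carrier G) \<subseteq> carrier (rat_tensor G)" by (auto simp: tensor_span_def)
  have "tensor_rel #>\<^bsub>free_pairs\<^esub> x \<in> tensor_span G (carrier G)" if "x \<in> carrier free_pairs" for x
    using that[simplified]
  proof (induction x rule: free_Abelian_group_induct[consumes 1])
    case 1
    have "tensor_rel #>\<^bsub>free_pairs\<^esub> 0 = \<one>\<^bsub>rat_tensor G\<^esub>"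
      using R.rcos_eq_one_iff[OF F.one_closed] R.one_closed by (simp add: tensor_group_def)
    then show ?case using pure_tensor_one[of 0] unfolding tensor_span_def by force
  next
    case (2 x y)
    then have xy: "x \<in> carrier free_pairs" "y \<in> carrier free_pairs" by auto
    obtain a r b s where a: "a \<in> carrier G" "tensor_rel #>\<^bsub>free_pairs\<^esub> x = pure_tensor G a r"
      and b: "b \<in> carrier G" "tensor_rel #>\<^bsub>free_pairs\<^esub> y = pure_tensor G b s"
      using 2 unfolding tensor_span_def by blast
    have my: "- y \<in> carrier free_pairs" using F.inv_closed[OF xy(2)] xy(2) by simp
    have "(tensor_rel #>\<^bsub>free_pairs\<^esub> - y) \<otimes>\<^bsub>rat_tensor G\<^esub> (tensor_rel #>\<^bsub>free_pairs\<^esub> y) = \<one>\<^bsub>rat_tensor G\<^esub>"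
      unfolding mult_tensor_coset[OF is_group group_rat_add my xy(2)]
      using R.rcos_eq_one_iff[OF F.one_closed] R.one_closed by (simp add: tensor_group_def)
    then have i: "tensor_rel #>\<^bsub>free_pairs\<^esub> - y = inv\<^bsub>rat_tensor G\<^esub> (tensor_rel #>\<^bsub>free_pairs\<^esub> y)"
      using my xy(2) by (intro T.inv_equality[symmetric]) (simp_all only: carrier_tensor[OF is_group group_rat_add] imageI)
    have "tensor_rel #>\<^bsub>free_pairs\<^esub> (x - y) = (tensor_rel #>\<^bsub>free_pairs\<^esub> x) \<otimes>\<^bsub>rat_tensor G\<^esub> (tensor_rel #>\<^bsub>free_pairs\<^esub> - y)"
      unfolding mult_tensor_coset[OF is_group group_rat_add xy(1) my] by simp
    also have "\<dots> = pure_tensor G a r \<otimes>\<^bsub>rat_tensor G\<^esub> pure_tensor G (inv b) s"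
      unfolding i a(2) b(2) using b(1) by (simp only: pure_tensor_inv)
    finally have e: "tensor_rel #>\<^bsub>free_pairs\<^esub> (x - y) = pure_tensor G a r \<otimes>\<^bsub>rat_tensor G\<^esub> pure_tensor G (inv b) s" .
    obtain p q :: int and t where "pure_tensor G a r \<otimes>\<^bsub>rat_tensor G\<^esub> pure_tensor G (inv b) s = pure_tensor G (a [^] p \<otimes> inv b [^] q) t"
      by (rule pure_tensor_mult[OF a(1) inv_closed[OF b(1)]])
    then show ?case unfolding e tensor_span_def using a(1) b(1) by auto
  next
    case (3 p)
    then show ?case by (cases p) (auto simp: tensor_span_def pure_tensor_def)
  qed
  then show "carrier (rat_tensor G) \<subseteq> tensor_span G (carrier G)"
    unfolding carrier_tensor[OF is_group group_rat_add] by blast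
qed

lemma tensor_endo_pure_tensor:
  assumes f: "f \<in> hom G G" and g: "g \<in> hom rat_add rat_add" and a: "a \<in> carrier G"
  shows "tensor_endo G rat_add f g (pure_tensor G a r) = pure_tensor G (f a) (g r)"
  unfolding pure_tensor_def tensor_endo_coset[OF is_group group_rat_add f g frag_of_carrier[OF a]]
  by simp

lemma rationalization_simps:
  "carrier (rationalization G) = tensor_span G (carrier G)"
  "x \<oplus>\<^bsub>rationalization G\<^esub> y = x \<otimes>\<^bsub>rat_tensor G\<^esub> y"
  "\<zero>\<^bsub>rationalization G\<^esub> = \<one>\<^bsub>rat_tensor G\<^esub>"
  "c \<odot>\<^bsub>rationalization G\<^esub> x = tensor_endo G rat_add id (\<lambda>r. c * r) x"
  unfolding rat_tensor_carrier[symmetric] unfolding rationalization_def rat_add_def by simp_all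

lemma tensor_span_subspace:
  assumes U: "subgroup U G"
  shows "subspace rat_field (tensor_span G U) (rationalization G)"
proof -
  interpret U: subgroup U G by (rule U)
  have V: "vectorspace rat_field (rationalization G)" by (rule vectorspace_rationalization[OF is_group])
  show ?thesis
  proof (intro subspace.intro submodule.intro V)
    show "module rat_field (rationalization G)" using V by (simp add: vectorspace_def)
    show "tensor_span G U \<subseteq> carrier (rationalization G)"
      unfolding rationalization_simps tensor_span_def by auto
    show "\<zero>\<^bsub>rationalization G\<^esub> \<in> tensor_span G U"
      unfolding rationalization_simps tensor_span_def using pure_tensor_one[of 0] U.one_closed by force
  next
    fix v w assume "v \<in> tensor_span G U" "w \<in> tensor_span G U"
    then obtain a b r s where a: "a \<in> U" "v = pure_tensor G a r" and b: "b \<in> U" "w = pure_tensor G b s"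
      unfolding tensor_span_def by blast
    obtain p q :: int and t where "pure_tensor G a r \<otimes>\<^bsub>rat_tensor G\<^esub> pure_tensor G b s = pure_tensor G (a [^] p \<otimes> b [^] q) t"
      by (rule pure_tensor_mult[OF U.mem_carrier[OF a(1)] U.mem_carrier[OF b(1)]])
    moreover have "a [^] p \<otimes> b [^] q \<in> U" using subgroup_int_pow_closed[OF U] a b by simp
    ultimately show "v \<oplus>\<^bsub>rationalization G\<^esub> w \<in> tensor_span G U"
      unfolding rationalization_simps a(2) b(2) tensor_span_def by blast
  next
    fix c v assume "v \<in> tensor_span G U"
    then obtain a r where a: "a \<in> U" "v = pure_tensor G a r" unfolding tensor_span_def by blast
    then have "c \<odot>\<^bsub>rationalization G\<^esub> v = pure_tensor G a (c * r)"
      unfolding rationalization_simps a(2) by (simp add: tensor_endo_pure_tensor[OF id_hom mult_hom_rat_add])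
    then show "c \<odot>\<^bsub>rationalization G\<^esub> v \<in> tensor_span G U" unfolding tensor_span_def using a(1) by blast
  qed
qed

text \<open>The homomorphism \<open>a \<otimes> r \<mapsto> a\<^sup>d\<^sup>r\<close> is only defined on pairs with \<open>d r\<close> integral; a single
  relation becomes trivial as soon as \<open>d\<close> clears its denominators.\<close>

lemma tensor_relations_trivial:
  assumes x: "x \<in> tensor_rel"
  obtains D :: nat where "0 < D"
    "\<And>d h. D dvd d \<Longrightarrow> h \<in> hom free_pairs G \<Longrightarrow>
      (\<And>a r. a \<in> carrier G \<Longrightarrow> h (frag_of (a, r)) = a [^] \<lfloor>of_nat d * r\<rfloor>) \<Longrightarrow> h x = \<one>"
proof -
  \<comment> \<open>\<open>P x D\<close> says that \<open>D\<close> clears the denominators behind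
    the relation \<open>x\<close>. Quantifying over all multiples of \<open>D\<close> allows the
    bounds of two relations to be combined.\<close>
  define P where "P x D \<longleftrightarrow> (\<forall>d h. D dvd d \<longrightarrow> h \<in> hom free_pairs G \<longrightarrow>
      (\<forall>a r. a \<in> carrier G \<longrightarrow> h (frag_of (a, r)) = a [^] \<lfloor>of_nat d * r\<rfloor>) \<longrightarrow> h x = \<one>)" for x and D :: nat
  define S where "S = {frag_of (a \<otimes> a', b) - frag_of (a, b) - frag_of (a', b) | a a' b.
        a \<in> carrier G \<and> a' \<in> carrier G \<and> b \<in> carrier rat_add} \<union>
     {frag_of (a, b \<otimes>\<^bsub>rat_add\<^esub> b') - frag_of (a, b) - frag_of (a, b') | a b b'.
        a \<in> carrier G \<and> b \<in> carrier rat_add \<and> b' \<in> carrier rat_add}"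
  have RS: "tensor_rel = generate free_pairs S" by (simp only: tensor_relations_def S_def)
  have hd: "h (u - v - w) = h u \<otimes> inv h v \<otimes> inv h w"
    if h: "h \<in> hom free_pairs G" and u: "u \<in> carrier free_pairs" "v \<in> carrier free_pairs" "w \<in> carrier free_pairs" for h u v w
  proof -
    interpret h: group_hom free_pairs G h by (intro group_hom.intro group_hom_axioms.intro F.is_group is_group h)
    have "u - v - w = u \<otimes>\<^bsub>free_pairs\<^esub> inv\<^bsub>free_pairs\<^esub> v \<otimes>\<^bsub>free_pairs\<^esub> inv\<^bsub>free_pairs\<^esub> w" using u by simp
    then show ?thesis by (simp only: h.hom_mult h.hom_inv u F.m_closed F.inv_closed)
  qed
  have gen: "\<exists>D>0. P x D" if "x \<in> S" for x
    using that unfolding S_def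
  proof
    assume "x \<in> {frag_of (a \<otimes> a', b) - frag_of (a, b) - frag_of (a', b) | a a' b.
        a \<in> carrier G \<and> a' \<in> carrier G \<and> b \<in> carrier rat_add}"
    then obtain a a' b where x: "x = frag_of (a \<otimes> a', b) - frag_of (a, b) - frag_of (a', b)"
      and a: "a \<in> carrier G" "a' \<in> carrier G" by blast
    \<comment> \<open>Relations in the left variable compare powers with one and the same exponent,
      so rounding does no harm.\<close>
    have "P x 1" unfolding P_def
    proof (intro allI impI)
      fix d :: nat and h assume h: "h \<in> hom free_pairs G" "\<forall>a r. a \<in> carrier G \<longrightarrow> h (frag_of (a, r)) = a [^] \<lfloor>of_nat d * r\<rfloor>"
      show "h x = \<one>" unfolding x hd[OF h(1) frag_of_carrier[OF m_closed[OF a]] frag_of_carrier[OF a(1)] frag_of_carrier[OF a(2)]]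
        using h(2) a by (simp add: int_pow_distrib mult_mult_inv_inv)
    qed
    then show ?thesis by (intro exI[of _ 1]) simp
  next
    assume "x \<in> {frag_of (a, b \<otimes>\<^bsub>rat_add\<^esub> b') - frag_of (a, b) - frag_of (a, b') | a b b'.
        a \<in> carrier G \<and> b \<in> carrier rat_add \<and> b' \<in> carrier rat_add}"
    then obtain a b b' where x: "x = frag_of (a, b + b') - frag_of (a, b) - frag_of (a, b')"
      and a: "a \<in> carrier G" unfolding rat_add_simps by blast
    obtain p q and m :: nat where m: "0 < m" "b = of_int p / of_nat m" "b' = of_int q / of_nat m"
      by (rule rat_common_denominator)
    \<comment> \<open>When \<open>m\<close> divides \<open>d\<close>, the three numbers under the
      floors are integers and the exponents add exactly.\<close>
    have "P x m" unfolding P_def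
    proof (intro allI impI)
      fix d :: nat and h assume d: "m dvd d" and h: "h \<in> hom free_pairs G" "\<forall>a r. a \<in> carrier G \<longrightarrow> h (frag_of (a, r)) = a [^] \<lfloor>of_nat d * r\<rfloor>"
      obtain e where e: "d = m * e" using d by (rule dvdE)
      have "of_nat d * b = of_int (int e * p)" "of_nat d * b' = of_int (int e * q)"
        "of_nat d * (b + b') = of_int (int e * p + int e * q)"
        using m by (simp_all add: e field_simps)
      then have fl: "\<lfloor>of_nat d * b\<rfloor> = int e * p" "\<lfloor>of_nat d * b'\<rfloor> = int e * q"
        "\<lfloor>of_nat d * (b + b')\<rfloor> = int e * p + int e * q"
        by (simp_all only: floor_of_int)
      show "h x = \<one>" unfolding x hd[OF h(1) frag_of_carrier[OF a] frag_of_carrier[OF a] frag_of_carrier[OF a]]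
        using h(2) a by (simp add: fl int_pow_mult mult_mult_inv_inv)
    qed
    then show ?thesis using m(1) by blast
  qed
  have SF: "S \<subseteq> carrier free_pairs"
    using R.subset RS generate.incl by (metis subsetI subsetD)
  have "x \<in> generate free_pairs S" using x by (simp only: RS)
  then have "\<exists>D>0. P x D"
  proof (induction rule: generate.induct)
    case one
    then show ?case unfolding P_def by (intro exI[of _ 1]) (use hom_one[OF _ F.is_group is_group] in auto)
  next
    case (incl x)
    then show ?case by (rule gen)
  next
    case (inv x)
    then obtain D where D: "D > 0" "P x D" using gen by blast
    have "P (inv\<^bsub>free_pairs\<^esub> x) D"
      unfolding P_def
    proof (intro allI impI)
      fix d :: nat and h assume d: "D dvd d" and h: "h \<in> hom free_pairs G" "\<forall>a r. a \<in> carrier G \<longrightarrow> h (frag_of (a, r)) = a [^] \<lfloor>of_nat d * r\<rfloor>"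
      interpret h: group_hom free_pairs G h by (intro group_hom.intro group_hom_axioms.intro F.is_group is_group h)
      have "h x = \<one>" using D(2) d h unfolding P_def by blast
      then show "h (inv\<^bsub>free_pairs\<^esub> x) = \<one>" using h.hom_inv[OF subsetD[OF SF inv]] by simp
    qed
    then show ?case using D(1) by blast
  next
    case (eng x y)
    then obtain D E where D: "D > 0" "P x D" and E: "E > 0" "P y E" by blast
    have xy: "x \<in> carrier free_pairs" "y \<in> carrier free_pairs" using eng(1,2) R.subset unfolding RS by blast+
    have "P (x \<otimes>\<^bsub>free_pairs\<^esub> y) (D * E)"
      unfolding P_def
    proof (intro allI impI)
      fix d :: nat and h assume d: "D * E dvd d" and h: "h \<in> hom free_pairs G" "\<forall>a r. a \<in> carrier G \<longrightarrow> h (frag_of (a, r)) = a [^] \<lfloor>of_nat d * r\<rfloor>"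
      have "h x = \<one>" using D(2) dvd_mult_left[OF d] h unfolding P_def by blast
      moreover have "h y = \<one>" using E(2) dvd_mult_right[OF d] h unfolding P_def by blast
      ultimately show "h (x \<otimes>\<^bsub>free_pairs\<^esub> y) = \<one>" using hom_mult[OF h(1) xy] by simp
    qed
    then show ?case using D(1) E(1) by (intro exI[of _ "D * E"]) simp
  qed
  then show ?thesis using that unfolding P_def by blast
qed

text \<open>The generator (a,1) is then a relation. With the \<open>D\<close> belonging to it, the
  homomorphism that sends a generator (b,r) to the power of b with exponent the floor of D r is
  defined on all pairs; it kills the relation and maps it to \<open>a [^] D\<close>.\<close>

lemma pure_tensor_eq_one:
  assumes a: "a \<in> carrier G" and one: "pure_tensor G a 1 = \<one>\<^bsub>rat_tensor G\<^esub>"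
  obtains k :: nat where "0 < k" "a [^] k = \<one>"
proof -
  have "frag_of (a, 1) \<in> tensor_rel"
    using one R.rcos_eq_one_iff[OF frag_of_carrier[OF a]] unfolding pure_tensor_def by (simp add: tensor_group_def)
  then obtain D :: nat where D: "0 < D" 
    "\<And>d h. D dvd d \<Longrightarrow> h \<in> hom free_pairs G \<Longrightarrow>
      (\<And>a r. a \<in> carrier G \<Longrightarrow> h (frag_of (a, r)) = a [^] \<lfloor>of_nat d * r\<rfloor>) \<Longrightarrow> h (frag_of (a, 1)) = \<one>"
    by (rule tensor_relations_trivial) blast
  have "(\<lambda>(a, r). a [^] \<lfloor>of_nat D * r\<rfloor>) ` (carrier G \<times> carrier rat_add) \<subseteq> carrier G" by auto
  then obtain h where h: "h \<in> hom free_pairs G"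
    "\<And>x. x \<in> carrier G \<times> carrier rat_add \<Longrightarrow> h (frag_of x) = (case x of (a, r) \<Rightarrow> a [^] \<lfloor>of_nat D * r\<rfloor>)"
    by (rule free_Abelian_group_universal) blast
  have "h (frag_of (a, 1)) = \<one>" using D(2)[OF dvd_refl h(1)] h(2) by simp
  then have "a [^] D = \<one>" using h(2)[of "(a, 1)"] a by (simp add: int_pow_int)
  then show ?thesis using D(1) that by blast
qed

text \<open>If the tensor of \<open>a\<close> and 1 equals that of some \<open>u\<close> in
  \<open>U\<close> and p/m, then a^m and u^p have the same tensor with 1/m. Multiplying by m shows
  that a^m u^-p has trivial tensor with 1, so it is torsion, and a common power of a^m and u^p
  agrees.\<close>

lemma tensor_span_full:
  assumes U: "subgroup U G" and full: "tensor_span G U = carrier (rationalization G)" and a: "a \<in> carrier G"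
  obtains k :: nat where "0 < k" "a [^] k \<in> U"
proof -
  interpret U: subgroup U G by (rule U)
  have "pure_tensor G a 1 \<in> tensor_span G U"
    unfolding full rationalization_simps(1) using a by (rule pure_tensor_in_span)
  then obtain u r where u: "u \<in> U" "pure_tensor G a 1 = pure_tensor G u r" unfolding tensor_span_def by blast
  obtain p q and m :: nat where m: "0 < m" "r = of_int p / of_nat m" "r = of_int q / of_nat m"
    by (rule rat_common_denominator)
  have uG: "u \<in> carrier G" using u(1) by simp
  have "pure_tensor G (a [^] int m) (1 / of_nat m) = pure_tensor G (u [^] p) (1 / of_nat m)"
    using u(2) m uG a by (simp add: pure_tensor_int_pow)
  then have "pure_tensor G (a [^] int m \<otimes> inv (u [^] p)) (1 / of_nat m) = \<one>\<^bsub>rat_tensor G\<^esub>"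
    using a uG by (simp add: pure_tensor_mult_left pure_tensor_inv[symmetric])
  then have "pure_tensor G ((a [^] int m \<otimes> inv (u [^] p)) [^] int m) (1 / of_nat m) = \<one>\<^bsub>rat_tensor G\<^esub>"
    using a uG hom_int_pow[of "\<lambda>a. pure_tensor G a (1 / of_nat m)" G "rat_tensor G" _ "int m"]
    by (simp add: hom_def pure_tensor_mult_left)
  then have "pure_tensor G (a [^] int m \<otimes> inv (u [^] p)) 1 = \<one>\<^bsub>rat_tensor G\<^esub>"
    using a uG m(1) by (simp add: pure_tensor_int_pow)
  then obtain k :: nat where k: "0 < k" "(a [^] int m \<otimes> inv (u [^] p)) [^] k = \<one>"
    using a uG by (elim pure_tensor_eq_one[rotated]) auto
  have "(a [^] int m) [^] k = (a [^] int m \<otimes> inv (u [^] p)) [^] k \<otimes> (u [^] p) [^] k"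
    using a uG by (simp add: nat_pow_distrib[symmetric] m_assoc)
  then have "a [^] (m * k) = (u [^] p) [^] k" using k(2) a uG by (simp add: int_pow_int nat_pow_pow)
  then have "a [^] (m * k) \<in> U" 
    using subgroup_nat_pow_closed[OF U subgroup_int_pow_closed[OF U u(1)]] by simp
  then show ?thesis using m(1) k(1) that by (metis nat_0_less_mult_iff)
qed

lemma tensor_endo_tensor_span:
  assumes f: "f \<in> hom G G" and U: "U \<subseteq> carrier G"
  shows "tensor_endo G rat_add f id ` tensor_span G U = tensor_span G (f ` U)"
proof -
  have e: "tensor_endo G rat_add f id (pure_tensor G a r) = pure_tensor G (f a) r" if "a \<in> U" for a r
    using tensor_endo_pure_tensor[OF f id_hom subsetD[OF U that]] by simp
  show ?thesis
  proof (intro subset_antisym subsetI)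
    fix v assume "v \<in> tensor_endo G rat_add f id ` tensor_span G U"
    then obtain a r where "a \<in> U" "v = tensor_endo G rat_add f id (pure_tensor G a r)"
      unfolding tensor_span_def by blast
    then show "v \<in> tensor_span G (f ` U)" by (simp add: e pure_tensor_in_span)
  next
    fix v assume "v \<in> tensor_span G (f ` U)"
    then obtain a r where a: "a \<in> U" "v = pure_tensor G (f a) r"
      unfolding tensor_span_def by blast
    then have "v = tensor_endo G rat_add f id (pure_tensor G a r)" by (simp only: e)
    then show "v \<in> tensor_endo G rat_add f id ` tensor_span G U"
      using pure_tensor_in_span[OF a(1)] by blast
  qed
qed

lemma tensor_span_mono: "U \<subseteq> W \<Longrightarrow> tensor_span G U \<subseteq> tensor_span G W"
  unfolding tensor_span_def by blast

end

section \<open>Rank and finite covers\<close>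

text \<open>On a subspace of a finite-dimensional space this is the dimension, computed inside
  \<open>V\<close>, so that no subspace has to be turned into a vector space of its own.\<close>

definition (in vectorspace) indep_rank :: "'c set \<Rightarrow> nat"
  where "indep_rank W = Max (card ` {B. B \<subseteq> W \<and> lin_indpt B})"

context vectorspace
begin

lemma lin_indpt_empty: "lin_indpt {}"
  unfolding lin_dep_def by blast

lemma indep_rank_bounds:
  assumes fd: "fin_dim" and W: "W \<subseteq> carrier V"
  shows "finite (card ` {B. B \<subseteq> W \<and> lin_indpt B})" "indep_rank W \<le> dim"
proof -
  have le: "card ` {B. B \<subseteq> W \<and> lin_indpt B} \<subseteq> {..dim}"
    using li_le_dim(2)[OF fd] W by blast
  then show fin: "finite (card ` {B. B \<subseteq> W \<and> lin_indpt B})" by (rule finite_subset) simp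
  have "indep_rank W \<in> card ` {B. B \<subseteq> W \<and> lin_indpt B}"
    unfolding indep_rank_def by (rule Max_in[OF fin]) (use lin_indpt_empty in blast)
  then show "indep_rank W \<le> dim" using le by blast
qed

lemma card_le_indep_rank:
  assumes "fin_dim" "W \<subseteq> carrier V" "B \<subseteq> W" "lin_indpt B"
  shows "card B \<le> indep_rank W"
  unfolding indep_rank_def by (rule Max_ge[OF indep_rank_bounds(1)[OF assms(1,2)]]) (use assms in blast)

lemma indep_rank_witness:
  assumes fd: "fin_dim" and W: "W \<subseteq> carrier V"
  obtains B where "B \<subseteq> W" "lin_indpt B" "finite B" "card B = indep_rank W"
proof -
  have "indep_rank W \<in> card ` {B. B \<subseteq> W \<and> lin_indpt B}"
    unfolding indep_rank_def by (rule Max_in[OF indep_rank_bounds(1)[OF assms]]) (use lin_indpt_empty in blast)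
  then obtain B where B: "B \<subseteq> W" "lin_indpt B" "indep_rank W = card B" by blast
  then show ?thesis using that fin_dim_li_fin[OF fd B(2)] W by fastforce
qed

text \<open>A largest independent subset of \<open>W\<close> spans nothing outside \<open>W\<close>,
  so a vector of \<open>W'\<close> outside \<open>W\<close> can be added to it.\<close>

lemma indep_rank_strict_mono:
  assumes fd: "fin_dim" and W: "submodule K W V" and W': "W' \<subseteq> carrier V" and less: "W \<subset> W'"
  shows "indep_rank W < indep_rank W'"
proof -
  have WV: "W \<subseteq> carrier V" using less W' by blast
  obtain B where B: "B \<subseteq> W" "lin_indpt B" "finite B" "card B = indep_rank W"
    by (rule indep_rank_witness[OF fd WV])
  obtain v where v: "v \<in> W'" "v \<notin> W" using less by blast
  have "span B \<subseteq> W" by (rule span_is_subset[OF B(1) W])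
  then have "v \<notin> span B" using v(2) by blast
  then have "lin_indpt (B \<union> {v})"
    using lin_dep_iff_in_span[of B v] B v W' WV by blast
  moreover have "v \<notin> B" using B(1) v(2) by blast
  then have "card (B \<union> {v}) = Suc (card B)" using B(3) by simp
  moreover have "B \<union> {v} \<subseteq> W'" using B(1) less v(1) by blast
  ultimately show ?thesis using card_le_indep_rank[OF fd W', of "B \<union> {v}"] B(4) by simp
qed

lemma indep_rank_zero: "indep_rank {\<zero>\<^bsub>V\<^esub>} = 0"
proof -
  have "B = {}" if "B \<subseteq> {\<zero>\<^bsub>V\<^esub>}" "lin_indpt B" for B
    using that vs_zero_lin_dep[of B] by blast
  then have "{B. B \<subseteq> {\<zero>\<^bsub>V\<^esub>} \<and> lin_indpt B} = {{}}" using lin_indpt_empty by blast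
  then show ?thesis unfolding indep_rank_def by simp
qed

end

lemma (in linear_map) lin_indpt_inj_image:
  assumes inj: "inj_on T (carrier V)" and B: "B \<subseteq> carrier V" "finite B" "V.module.lin_indpt B"
  shows "W.module.lin_indpt (T ` B)"
proof (rule W.module.finite_lin_indpt2)
  show "finite (T ` B)" using B by simp
  show "T ` B \<subseteq> carrier W" using B by auto
  fix a assume a: "a \<in> T ` B \<rightarrow> carrier K" and z: "W.module.lincomb a (T ` B) = \<zero>\<^bsub>W\<^esub>"
  have aT: "a \<circ> T \<in> B \<rightarrow> carrier K" using a by auto
  have c: "V.module.lincomb (a \<circ> T) B \<in> carrier V" using B aT by (intro V.module.lincomb_closed)
  have "T (V.module.lincomb (a \<circ> T) B) = T \<zero>\<^bsub>V\<^esub>"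
    using lincomb_linear_image[OF inj B(1) a B(2)] z by simp
  then have "V.module.lincomb (a \<circ> T) B = \<zero>\<^bsub>V\<^esub>"
    using inj_onD[OF inj _ c] by simp
  then have "a \<circ> T \<in> B \<rightarrow> {\<zero>\<^bsub>K\<^esub>}"
    using V.not_lindepD[OF B(3) B(2) subset_refl aT] by simp
  then show "\<forall>v\<in>T ` B. a v = \<zero>\<^bsub>K\<^esub>" by auto
qed

lemma (in linear_map) indep_rank_inj_image:
  assumes inj: "inj_on T (carrier V)" and fd: "V.fin_dim" "W.fin_dim" and U: "U \<subseteq> carrier V"
  shows "V.indep_rank U \<le> W.indep_rank (T ` U)"
proof -
  obtain B where B: "B \<subseteq> U" "V.module.lin_indpt B" "finite B" "card B = V.indep_rank U"
    by (rule V.indep_rank_witness[OF fd(1) U])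
  have "inj_on T B" using inj B(1) U by (meson inj_on_subset subset_trans)
  then have "V.indep_rank U = card (T ` B)" using B(4) by (simp add: card_image)
  also have "\<dots> \<le> W.indep_rank (T ` U)"
  proof (rule W.card_le_indep_rank[OF fd(2)])
    show "T ` U \<subseteq> carrier W" using U by auto
    show "T ` B \<subseteq> T ` U" using B(1) by (rule image_mono)
    show "W.module.lin_indpt (T ` B)" using B(1-3) U by (intro lin_indpt_inj_image[OF inj]) auto
  qed
  finally show ?thesis .
qed

text \<open>The name refers to up-sets: the sets lying above some member of \<open>C\<close> include
  all of \<open>F\<close>. In the application \<open>F\<close> consists of the point stabilizers in
  \<open>N\<close> and may be infinite.\<close>

definition covers :: "'a set set \<Rightarrow> 'a set set \<Rightarrow> 'a set set \<Rightarrow> bool"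
  where "covers \<U> F C \<longleftrightarrow> finite C \<and> C \<subseteq> \<U> \<and> (\<forall>H\<in>F. \<exists>U\<in>C. U \<subseteq> H)"

text \<open>Choose a cover whose smallest rank \<open>d\<close> is as large as possible and which has as few
  members of rank \<open>d\<close> as possible. Joining it with its translates cannot improve it, so the
  members of rank \<open>d\<close> are permuted.\<close>

lemma invariant_bottom_of_cover:
  fixes s :: "'a set \<Rightarrow> 'b set" and rk :: "'b set \<Rightarrow> nat"
  assumes F: "F \<noteq> {}"
    and join: "\<And>U U'. U \<in> \<U> \<Longrightarrow> U' \<in> \<U> \<Longrightarrow> j U U' \<in> \<U>"
      "\<And>U U'. U \<in> \<U> \<Longrightarrow> U' \<in> \<U> \<Longrightarrow> s U \<subseteq> s (j U U')"
      "\<And>U U'. U \<in> \<U> \<Longrightarrow> U' \<in> \<U> \<Longrightarrow> s U' \<subseteq> s (j U U')"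
      "\<And>U U' H. H \<in> F \<Longrightarrow> U \<subseteq> H \<Longrightarrow> U' \<subseteq> H \<Longrightarrow> j U U' \<subseteq> H"
    and rk_le: "\<And>U. U \<in> \<U> \<Longrightarrow> rk (s U) \<le> n"
    and rk_less: "\<And>U U'. U \<in> \<U> \<Longrightarrow> U' \<in> \<U> \<Longrightarrow> s U \<subset> s U' \<Longrightarrow> rk (s U) < rk (s U')"
    and act: "\<And>g U. g \<in> A \<Longrightarrow> U \<in> \<U> \<Longrightarrow> c g U \<in> \<U>"
      "\<And>g U. g \<in> A \<Longrightarrow> U \<in> \<U> \<Longrightarrow> s (c g U) = \<rho> g ` s U"
      "\<And>g U. g \<in> A \<Longrightarrow> U \<in> \<U> \<Longrightarrow> rk (s U) \<le> rk (s (c g U))"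
      "\<And>g H. g \<in> A \<Longrightarrow> H \<in> F \<Longrightarrow> \<exists>H'\<in>F. \<forall>U\<in>\<U>. U \<subseteq> H' \<longrightarrow> c g U \<subseteq> H"
    and C0: "covers \<U> F C0" "\<And>U. U \<in> C0 \<Longrightarrow> 0 < rk (s U)"
  obtains C D and d :: nat where "covers \<U> F C" "0 < d" "\<And>U. U \<in> C \<Longrightarrow> d \<le> rk (s U)"
    "D = s ` {U \<in> C. rk (s U) = d}" "D \<noteq> {}" "\<And>g. g \<in> A \<Longrightarrow> (`) (\<rho> g) ` D = D"
proof -
  define P where "P d C \<longleftrightarrow> covers \<U> F C \<and> (\<forall>U\<in>C. d \<le> rk (s U))" for d C
  \<comment> \<open>Spans are counted rather than members of \<open>C\<close>: joins may create new
    subgroups, but at rank \<open>d\<close> they create no new spans.\<close>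
  define bottom where "bottom d C = s ` {U \<in> C. rk (s U) = d}" for d C
  \<comment> \<open>\<open>F\<close> is nonempty, so a cover has a member and its least rank is at
    most \<open>n\<close>; hence a greatest \<open>d\<close> exists.\<close>
  have bound: "d \<le> n" if ex: "\<exists>C. P d C" for d
  proof -
    obtain C where C: "P d C" using ex ..
    obtain H where H: "H \<in> F" using F by (meson ex_in_conv)
    obtain U where U: "U \<in> C" using C H by (auto simp: P_def covers_def)
    then have "U \<in> \<U>" "d \<le> rk (s U)" using C by (auto simp: P_def covers_def)
    then show ?thesis using rk_le[of U] by simp
  qed
  \<comment> \<open>The positive ranks in \<open>C0\<close> provide level 1, which is why the
    maximal \<open>d\<close> is positive.\<close>
  have P1: "\<exists>C. P 1 C" using C0 unfolding P_def by (intro exI[of _ C0]) (auto simp: Suc_le_eq)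
  define d where "d = (GREATEST d. \<exists>C. P d C)"
  have d: "\<exists>C. P d C" unfolding d_def by (rule GreatestI_nat[where P = "\<lambda>d. \<exists>C. P d C", OF P1 bound])
  have max: "e \<le> d" if "P e C" for e C
    unfolding d_def by (rule Greatest_le_nat[where P = "\<lambda>d. \<exists>C. P d C", OF exI[of _ C] bound], rule that)
  have "0 < d" using P1 max by (metis One_nat_def Suc_le_eq)
  obtain C where C: "P d C" and min: "\<And>C'. P d C' \<Longrightarrow> card (bottom d C) \<le> card (bottom d C')"
    using d ex_has_least_nat[of "P d" _ "\<lambda>C. card (bottom d C)"] by metis
  have Cfin: "finite C" and CU: "\<And>U. U \<in> C \<Longrightarrow> U \<in> \<U>" and Cd: "\<And>U. U \<in> C \<Longrightarrow> d \<le> rk (s U)"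
    using C unfolding P_def covers_def by blast+
  define D where "D = bottom d C"
  have Dfin: "finite D" unfolding D_def bottom_def using Cfin by simp
  \<comment> \<open>Without a span of rank \<open>d\<close> the same cover would reach level
    \<open>Suc d\<close>.\<close>
  have "D \<noteq> {}"
  proof
    assume "D = {}"
    then have "P (Suc d) C"
      using C unfolding P_def D_def bottom_def by (auto simp: Suc_le_eq order_less_le)
    then show False using max by fastforce
  qed
  have le_eq: "s U = s U' \<and> rk (s U) = e" if "U \<in> \<U>" "U' \<in> \<U>" "s U \<subseteq> s U'" "e \<le> rk (s U)" "rk (s U') = e" for U U' e
    using rk_less[OF that(1,2)] that(3-5) by (cases "s U = s U'") auto
  have inv: "(`) (\<rho> g) ` D = D" if g: "g \<in> A" for g
  proof -
    \<comment> \<open>A set \<open>H\<close> in \<open>F\<close> contains some \<open>U\<close> from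
      \<open>C\<close>, and also the translate of some \<open>U'\<close> from \<open>C\<close> that
      lies below the set \<open>H'\<close> given by \<open>act(4)\<close>. Nothing relates
      \<open>U\<close> and \<open>U'\<close>, so all pairs are joined.\<close>
    define C' where "C' = (\<lambda>(U, U'). j U (c g U')) ` (C \<times> C)"
    have "covers \<U> F C'"
      unfolding covers_def
    proof (intro conjI ballI)
      show "finite C'" unfolding C'_def using Cfin by simp
      show "C' \<subseteq> \<U>" unfolding C'_def using join(1) act(1)[OF g] CU by auto
      fix H assume H: "H \<in> F"
      obtain H' where H': "H' \<in> F" "\<And>U. U \<in> \<U> \<Longrightarrow> U \<subseteq> H' \<Longrightarrow> c g U \<subseteq> H" using act(4)[OF g H] by blast
      obtain U U' where U: "U \<in> C" "U \<subseteq> H" "U' \<in> C" "U' \<subseteq> H'"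
        using C H H'(1) unfolding P_def covers_def by meson
      have "j U (c g U') \<subseteq> H" using join(4)[OF H U(2)] H'(2)[OF CU[OF U(3)] U(4)] by blast
      then show "\<exists>U\<in>C'. U \<subseteq> H" unfolding C'_def using U(1,3) by force
    qed
    \<comment> \<open>If the join does not exceed rank \<open>d\<close>, strict monotonicity of the
      rank turns both inclusions of spans into equalities, so its span is common to \<open>C\<close>
      and the translate of \<open>C\<close>.\<close>
    have low: "s U = s (j U (c g U')) \<and> rk (s U) = rk (s (j U (c g U'))) \<and>
        s (c g U') = s (j U (c g U')) \<and> rk (s U') = d"
      if U: "U \<in> C" "U' \<in> C" and r: "rk (s (j U (c g U'))) \<le> d" for U U'
    proof -
      note UU = CU[OF U(1)] act(1)[OF g CU[OF U(2)]]
      have d1: "d \<le> rk (s U)" "d \<le> rk (s (c g U'))" "d \<le> rk (s U')"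
        using Cd U act(3)[OF g CU[OF U(2)]] by (auto intro: order_trans)
      have "rk (s U) \<le> rk (s (j U (c g U')))"
        using rk_less[OF UU(1) join(1)[OF UU]] join(2)[OF UU]
        by (metis psubsetI order_less_imp_le order_refl)
      then have r': "rk (s (j U (c g U'))) = d" using d1(1) r by simp
      have "s U = s (j U (c g U')) \<and> rk (s U) = d"
        by (rule le_eq[OF UU(1) join(1)[OF UU] join(2)[OF UU] d1(1) r'])
      moreover have "s (c g U') = s (j U (c g U')) \<and> rk (s (c g U')) = d"
        by (rule le_eq[OF UU(2) join(1)[OF UU] join(3)[OF UU] d1(2) r'])
      ultimately show ?thesis using r' d1(3) act(3)[OF g CU[OF U(2)]] by simp
    qed
    have "d \<le> rk (s W)" if W: "W \<in> C'" for W
    proof -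
      obtain U U' where U: "U \<in> C" "U' \<in> C" "W = j U (c g U')" using W unfolding C'_def by auto
      then show ?thesis using low[OF U(1,2)] Cd[OF U(1)] by (cases "rk (s W) \<le> d") auto
    qed
    then have "P d C'" using \<open>covers \<U> F C'\<close> unfolding P_def by blast
    then have card: "card D \<le> card (bottom d C')" unfolding D_def by (rule min)
    \<comment> \<open>The bottom spans of \<open>C'\<close> lie in \<open>D\<close> and in the
      translate of \<open>D\<close>. By minimality they number at least \<open>card D\<close>, so
      they are all of \<open>D\<close>; thus \<open>D\<close> is contained in its translate, which
      has at most as many elements.\<close>
    have both: "W \<in> D \<and> W \<in> (`) (\<rho> g) ` D" if W: "W \<in> bottom d C'" for W
    proof -
      obtain U U' where U: "U \<in> C" "U' \<in> C" "W = s (j U (c g U'))" "rk W = d"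
        using W unfolding C'_def bottom_def by auto
      then have "W = s U" "rk (s U) = d" "W = \<rho> g ` s U'" "rk (s U') = d"
        using low[OF U(1,2)] act(2)[OF g CU[OF U(2)]] by auto
      then show ?thesis unfolding D_def bottom_def using U(1,2) by blast
    qed
    then have "bottom d C' \<subseteq> D" by blast
    then have "bottom d C' = D" using card_seteq[OF Dfin _ card] by blast
    then have sub: "D \<subseteq> (`) (\<rho> g) ` D" using both by blast
    have "D = (`) (\<rho> g) ` D"
      by (rule card_seteq[OF _ sub]) (use Dfin in \<open>auto intro: card_image_le\<close>)
    then show ?thesis by simp
  qed
  show ?thesis
    by (rule that[of C d D]) (use C \<open>0 < d\<close> Cd \<open>D \<noteq> {}\<close> inv in \<open>auto simp: P_def D_def bottom_def\<close>)
qed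

section \<open>Strongly irreducible extensions\<close>

locale strongly_irreducible_ext =
  fixes N and G :: "('g, 'm) monoid_scheme" and Q :: "('q, 'n) monoid_scheme" and \<pi>
  assumes sie: "strongly_irreducible_extension N G Q \<pi>"
begin

abbreviation "NG \<equiv> G\<lparr>carrier := N\<rparr>"
abbreviation "A \<equiv> abelianization NG"
abbreviation "V \<equiv> rationalization A"
abbreviation "D \<equiv> derived G N"

definition to_ab :: "'g \<Rightarrow> 'g set"
  where "to_ab n = D #>\<^bsub>G\<^esub> n"

definition rat_span :: "'g set \<Rightarrow> ('g set \<times> rat \<Rightarrow>\<^sub>0 int) set set"
  where "rat_span U = tensor_span A (to_ab ` U)"

definition conj_set :: "'g \<Rightarrow> 'g set \<Rightarrow> 'g set"
  where "conj_set g U = (\<lambda>n. g \<otimes>\<^bsub>G\<^esub> n \<otimes>\<^bsub>G\<^esub> inv\<^bsub>G\<^esub> g) ` U"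

lemma ext: "group_extension N G Q \<pi>"
  using sie by (simp add: strongly_irreducible_extension_def)

end

sublocale strongly_irreducible_ext \<subseteq> G: group G
  using ext by (simp add: group_extension_def)

sublocale strongly_irreducible_ext \<subseteq> pi: group_hom G Q \<pi>
  using ext by (intro group_hom.intro group_hom_axioms.intro) (auto simp: group_extension_def epi_def)

sublocale strongly_irreducible_ext \<subseteq> N: normal N G
  using pi.normal_kernel ext by (simp add: group_extension_def)

sublocale strongly_irreducible_ext \<subseteq> NG: group NG
  by (rule G.subgroup_imp_group[OF N.subgroup_axioms])

sublocale strongly_irreducible_ext \<subseteq> D: normal D G
  by (rule G.derived_is_normal[OF N.normal_axioms])

sublocale strongly_irreducible_ext \<subseteq> A: comm_group A
  by (rule abgroup[OF ext])

sublocale strongly_irreducible_ext \<subseteq> V: vectorspace rat_field V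
  by (rule vectorspace_rationalization[OF A.is_group])

sublocale strongly_irreducible_ext \<subseteq> rep: linear_representation Q rat_field V "conj_rep N G \<pi>"
  by (rule linear_representation_conj_rep[OF ext])

section \<open>Rational spans of subgroups of \<open>N\<close> under conjugation\<close>

context strongly_irreducible_ext
begin

lemma fin_dim: "V.fin_dim"
  using sie by (simp add: strongly_irreducible_extension_def)

lemma group_hom_to_ab: "group_hom NG A to_ab"
  by (intro group_hom.intro group_hom_axioms.intro homI NG.is_group A.is_group)
    (auto simp: to_ab_def carrier_ab[OF ext] mult_ab[OF ext])

sublocale to_ab: group_hom NG A to_ab
  by (rule group_hom_to_ab)

lemma carrier_A: "carrier A = to_ab ` N"
  by (simp add: carrier_ab[OF ext] to_ab_def)

lemma to_ab_eq_one_iff: "n \<in> N \<Longrightarrow> to_ab n = \<one>\<^bsub>A\<^esub> \<longleftrightarrow> n \<in> D"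
  unfolding to_ab_def abelianization_def derived_NG[OF ext] 
  using D.rcos_eq_one_iff[of n] by (simp add: derived_NG[OF ext])

lemma subgroup_to_ab: "subgroup U NG \<Longrightarrow> subgroup (to_ab ` U) A"
  by (rule to_ab.subgroup_img_is_subgroup)

lemma rat_span_subspace: "subgroup U NG \<Longrightarrow> subspace rat_field (rat_span U) V"
  unfolding rat_span_def by (rule A.tensor_span_subspace[OF subgroup_to_ab])

lemma rat_span_carrier: "subgroup U NG \<Longrightarrow> rat_span U \<subseteq> carrier V"
  using rat_span_subspace[of U] by (meson subspace_def submodule.subset)

lemma rat_span_mono: "U \<subseteq> W \<Longrightarrow> rat_span U \<subseteq> rat_span W"
  unfolding rat_span_def by (rule A.tensor_span_mono[OF image_mono])

lemma conj_rep_rat_span: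
  assumes g: "g \<in> carrier G" and U: "subgroup U NG"
  shows "conj_rep N G \<pi> (\<pi> g) ` rat_span U = rat_span (conj_set g U)"
proof -
  have UN: "U \<subseteq> N" using subgroup.subset[OF U] by simp
  have "conj_coset G g ` to_ab ` U = to_ab ` conj_set g U"
    using conj_coset_rcos[OF ext g subsetD[OF UN]]
    unfolding to_ab_def conj_set_def image_image by (intro image_cong refl) blast
  moreover have "to_ab ` U \<subseteq> carrier A" using UN carrier_A by blast
  ultimately show ?thesis
    unfolding conj_rep_lift[OF ext g] rat_span_def rat_add_def[symmetric]
    using A.tensor_endo_tensor_span[OF conj_coset_hom[OF ext g]] by metis
qed

lemma subgroup_conj_set:
  assumes g: "g \<in> carrier G" and U: "subgroup U NG"
  shows "subgroup (conj_set g U) NG"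
proof -
  have "(\<lambda>n. g \<otimes>\<^bsub>G\<^esub> n \<otimes>\<^bsub>G\<^esub> inv\<^bsub>G\<^esub> g) \<in> hom NG NG"
  proof (rule homI)
    fix x y assume "x \<in> carrier NG" "y \<in> carrier NG"
    then have "x \<in> carrier G" "y \<in> carrier G" by auto
    then show "g \<otimes>\<^bsub>G\<^esub> (x \<otimes>\<^bsub>NG\<^esub> y) \<otimes>\<^bsub>G\<^esub> inv\<^bsub>G\<^esub> g =
      (g \<otimes>\<^bsub>G\<^esub> x \<otimes>\<^bsub>G\<^esub> inv\<^bsub>G\<^esub> g) \<otimes>\<^bsub>NG\<^esub> (g \<otimes>\<^bsub>G\<^esub> y \<otimes>\<^bsub>G\<^esub> inv\<^bsub>G\<^esub> g)"
      using G.conj_mult[OF g] by simp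
  qed (use N.inv_op_closed2[OF g] in simp)
  then have "group_hom NG NG (\<lambda>n. g \<otimes>\<^bsub>G\<^esub> n \<otimes>\<^bsub>G\<^esub> inv\<^bsub>G\<^esub> g)"
    by (intro group_hom.intro group_hom_axioms.intro NG.is_group)
  then show ?thesis unfolding conj_set_def using U by (rule group_hom.subgroup_img_is_subgroup)
qed

lemma conj_rep_inj:
  assumes g: "g \<in> carrier G"
  shows "linear_map rat_field V V (conj_rep N G \<pi> (\<pi> g))"
    "inj_on (conj_rep N G \<pi> (\<pi> g)) (carrier V)"
proof -
  have "\<pi> g \<in> carrier Q" using g by simp
  then have *: "conj_rep N G \<pi> (\<pi> g) \<in> Bij (carrier V) \<inter> module_hom rat_field V V"
    using hom_in_carrier[OF rep.hom] by (simp add: general_linear_group_def)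
  then show "inj_on (conj_rep N G \<pi> (\<pi> g)) (carrier V)" by (simp add: Bij_def bij_betw_def)
  show "linear_map rat_field V V (conj_rep N G \<pi> (\<pi> g))"
    using * V.vectorspace_axioms V.module_axioms
    by (intro linear_map.intro mod_hom.intro mod_hom_axioms.intro) simp_all
qed

lemma rank_conj_set:
  assumes g: "g \<in> carrier G" and U: "subgroup U NG"
  shows "V.indep_rank (rat_span U) \<le> V.indep_rank (rat_span (conj_set g U))"
  using linear_map.indep_rank_inj_image[OF conj_rep_inj[OF g] fin_dim fin_dim rat_span_carrier[OF U]]
  unfolding conj_rep_rat_span[OF g U] .

lemma rank_strict_mono:
  assumes "subgroup U NG" "W \<subseteq> carrier V" "rat_span U \<subset> W"
  shows "V.indep_rank (rat_span U) < V.indep_rank W"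
  by (rule V.indep_rank_strict_mono[OF fin_dim _ assms(2,3)])
    (use rat_span_subspace[OF assms(1)] in \<open>simp add: subspace_def\<close>)

lemma pow_NG: "x [^]\<^bsub>NG\<^esub> (k::nat) = x [^]\<^bsub>G\<^esub> k"
  by (simp add: G.nat_pow_consistent[symmetric])

text \<open>If the tensor of \<open>to_ab t\<close> with 1 were zero, \<open>t\<close> would be
  torsion in N^ab; so the span is strictly larger than the zero subspace.\<close>

lemma rank_pos:
  assumes U: "subgroup U NG" and t: "t \<in> U" and tor: "\<And>k::nat. 0 < k \<Longrightarrow> t [^]\<^bsub>G\<^esub> k \<notin> D"
  shows "0 < V.indep_rank (rat_span U)"
proof -
  have tN: "t \<in> N" using subgroup.mem_carrier[OF U t] by simp
  have z: "\<zero>\<^bsub>V\<^esub> \<in> rat_span U" by (rule LinearCombinations.submodule.zero_closed[OF subspace.submod[OF rat_span_subspace[OF U]]])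
  have pt: "pure_tensor A (to_ab t) 1 \<in> rat_span U"
    unfolding rat_span_def by (rule pure_tensor_in_span) (use t in blast)
  have "pure_tensor A (to_ab t) 1 \<noteq> \<zero>\<^bsub>V\<^esub>"
  proof
    assume "pure_tensor A (to_ab t) 1 = \<zero>\<^bsub>V\<^esub>"
    then have "pure_tensor A (to_ab t) 1 = \<one>\<^bsub>rat_tensor A\<^esub>" by (simp only: A.rationalization_simps)
    moreover have "to_ab t \<in> carrier A" using tN carrier_A by blast
    ultimately obtain k :: nat where k: "0 < k" "to_ab t [^]\<^bsub>A\<^esub> k = \<one>\<^bsub>A\<^esub>"
      by (elim A.pure_tensor_eq_one[rotated])
    have "to_ab (t [^]\<^bsub>G\<^esub> k) = \<one>\<^bsub>A\<^esub>"
      using to_ab.hom_nat_pow[of t k] tN k(2) by (simp add: pow_NG)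
    moreover have "t [^]\<^bsub>G\<^esub> k \<in> N" using NG.nat_pow_closed[of t k] tN by (simp add: pow_NG)
    ultimately have "t [^]\<^bsub>G\<^esub> k \<in> D" by (simp add: to_ab_eq_one_iff)
    then show False using tor k(1) by blast
  qed
  then have "{\<zero>\<^bsub>V\<^esub>} \<subset> rat_span U" using z pt by blast
  moreover have "submodule rat_field {\<zero>\<^bsub>V\<^esub>} V"
    using V.module_axioms by (intro submodule.intro) auto
  ultimately show ?thesis
    using V.indep_rank_strict_mono[OF fin_dim _ rat_span_carrier[OF U]] by fastforce
qed

text \<open>A full span means that N^ab modulo the image of \<open>U\<close> is torsion, which is
  the condition that \<open>nilpotent_power_in_subgroup\<close> lifts to \<open>N\<close>.\<close>

lemma full_span_power:
  assumes nil: "nilpotent_group NG" and U: "subgroup U NG" and full: "rat_span U = carrier V"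
    and x: "x \<in> N"
  obtains k :: nat where "0 < k" "x [^]\<^bsub>G\<^esub> k \<in> U"
proof -
  have UN: "U \<subseteq> N" using subgroup.subset[OF U] by simp
  have "power_rel NG (derived NG (carrier NG)) U y" if "y \<in> carrier NG" for y
  proof -
    have yN: "y \<in> N" using that by simp
    then have "to_ab y \<in> carrier A" using carrier_A by blast
    then obtain k :: nat where k: "0 < k" "to_ab y [^]\<^bsub>A\<^esub> k \<in> to_ab ` U"
      using A.tensor_span_full[OF subgroup_to_ab[OF U]] full unfolding rat_span_def by blast
    then obtain u where u: "u \<in> U" "to_ab y [^]\<^bsub>A\<^esub> k = to_ab u" by blast
    have "to_ab (y [^]\<^bsub>NG\<^esub> k) = to_ab u" using to_ab.hom_nat_pow[of y k] that u(2) by simp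
    then show ?thesis
      using k(1) u(1) unfolding power_rel_def to_ab_def derived_NG[OF ext] by auto
  qed
  then obtain k :: nat where "0 < k" "x [^]\<^bsub>NG\<^esub> k \<in> U"
    using NG.nilpotent_power_in_subgroup[OF nil U _, of x] x by auto
  then show ?thesis using that by (simp add: pow_NG)
qed

text \<open>If \<open>carrier V\<close> were missing, all members would be non-trivial proper
  subspaces, and their union would be preserved because they are permuted.\<close>

lemma invariant_family_full:
  assumes D: "finite \<D>" "\<D> \<noteq> {}" "\<And>W. W \<in> \<D> \<Longrightarrow> subspace rat_field W V \<and> W \<noteq> {\<zero>\<^bsub>V\<^esub>}"
    and inv: "\<And>g. g \<in> carrier G \<Longrightarrow> (`) (conj_rep N G \<pi> (\<pi> g)) ` \<D> = \<D>"
  shows "carrier V \<in> \<D>"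
proof (rule ccontr)
  assume no: "carrier V \<notin> \<D>"
  have "\<pi> ` carrier G = carrier Q" using ext by (simp add: group_extension_def epi_def)
  have "conj_rep N G \<pi> q ` \<Union>\<D> = \<Union>\<D>" if q: "q \<in> carrier Q" for q
  proof -
    obtain g where g: "g \<in> carrier G" "q = \<pi> g" using q \<open>\<pi> ` carrier G = carrier Q\<close> by blast
    have "conj_rep N G \<pi> q ` \<Union>\<D> = \<Union> ((`) (conj_rep N G \<pi> (\<pi> g)) ` \<D>)"
      unfolding g(2) by (rule image_Union)
    then show ?thesis by (simp only: inv[OF g(1)])
  qed
  moreover have "rep.strongly_irreducible"
    using sie by (simp add: strongly_irreducible_extension_def)
  ultimately show False
    unfolding rep.strongly_irreducible_def using D no by metis
qed

text \<open>In the application \<Sigma> consists of the quotients of pairs that orbit maps may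
  identify, so \<open>meets\<close> says that no orbit map is injective. The contradiction is a
  power of some \<open>t\<close> in \<Sigma> that acts trivially: it equals 1, although no positive
  power of \<open>t\<close> lies in \<open>D\<close>.\<close>

lemma stabilizer_meets_imp_trivial_power:
  assumes nil: "nilpotent_group NG" and E: "E \<noteq> {}" and act: "faithful_action G E \<phi>"
    and \<Sigma>: "finite \<Sigma>" "\<Sigma> \<subseteq> N" "\<And>t k. t \<in> \<Sigma> \<Longrightarrow> 0 < (k::nat) \<Longrightarrow> t [^]\<^bsub>G\<^esub> k \<notin> D"
    and meets: "\<And>x. x \<in> E \<Longrightarrow> \<exists>t\<in>\<Sigma>. \<phi> t x = x"
  shows False
proof -
  interpret act: faithful_action G E \<phi> by (rule act)
  define H where "H x = {n \<in> N. \<phi> n x = x}" for x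
  have HN: "H x = N \<inter> stabilizer G \<phi> x" for x unfolding H_def stabilizer_def by auto
  have H_sub: "subgroup (H x) G" if "x \<in> E" for x
    unfolding HN by (intro G.subgroups_Inter_pair N.subgroup_axioms act.stabilizer_subgroup that)
  have H_subNG: "subgroup (H x) NG" if "x \<in> E" for x
    using G.subgroup_incl[OF H_sub[OF that] N.subgroup_axioms] unfolding HN by blast
  have gen_le: "generate NG S \<subseteq> H x" if "x \<in> E" "S \<subseteq> H x" for S x
    by (rule NG.generate_subgroup_incl[OF that(2) H_subNG[OF that(1)]])
  have gen_sub: "subgroup (generate NG S) NG" if "S \<subseteq> N" for S
    using NG.generate_is_subgroup[of S] that by simp
  \<comment> \<open>The stabilizer of \<open>x\<close> contains the conjugate by \<open>g\<close> of
    the stabilizer of g^-1 x, also after intersecting with \<open>N\<close>, which is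
    normal.\<close>
  have conjH: "conj_set g U \<subseteq> H x" if g: "g \<in> carrier G" and x: "x \<in> E" and U: "U \<subseteq> H (\<phi> (inv\<^bsub>G\<^esub> g) x)" for g x U
  proof
    fix n' assume "n' \<in> conj_set g U"
    then obtain n where n: "n \<in> U" "n' = g \<otimes>\<^bsub>G\<^esub> n \<otimes>\<^bsub>G\<^esub> inv\<^bsub>G\<^esub> g" unfolding conj_set_def by blast
    have nN: "n \<in> N" "\<phi> n (\<phi> (inv\<^bsub>G\<^esub> g) x) = \<phi> (inv\<^bsub>G\<^esub> g) x" using n(1) U unfolding H_def by auto
    have nG: "n \<in> carrier G" using nN(1) by simp
    have y: "\<phi> (inv\<^bsub>G\<^esub> g) x \<in> E" using act.element_image[OF G.inv_closed[OF g] x] by blast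
    have "\<phi> n' x = \<phi> (g \<otimes>\<^bsub>G\<^esub> n) (\<phi> (inv\<^bsub>G\<^esub> g) x)"
      unfolding n(2) using g nG x by (intro act.composition_rule) auto
    also have "\<dots> = \<phi> g (\<phi> n (\<phi> (inv\<^bsub>G\<^esub> g) x))"
      using g nG y by (intro act.composition_rule) auto
    also have "\<dots> = \<phi> (g \<otimes>\<^bsub>G\<^esub> inv\<^bsub>G\<^esub> g) x"
      unfolding nN(2) using g x by (intro act.composition_rule[symmetric]) auto
    also have "\<dots> = x" using g x act.id_eq_one by (metis G.r_inv restrict_apply')
    finally show "n' \<in> H x" using N.inv_op_closed2[OF g nN(1)] unfolding H_def n(2) by simp
  qed
  let ?S = "{U. subgroup U NG}"
  \<comment> \<open>The cyclic groups generated by the elements of \<Sigma>: by \<open>meets\<close>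
    every stabilizer contains one of them, and their spans are non-zero because the generators have
    infinite order in N^ab.\<close>
  define C0 where "C0 = (\<lambda>t. generate NG {t}) ` \<Sigma>"
  have C0sub: "subgroup (generate NG {t}) NG" if "t \<in> \<Sigma>" for t
    using gen_sub[of "{t}"] \<Sigma>(2) that by blast
  have cov: "covers ?S (H ` E) C0"
    unfolding covers_def
  proof (intro conjI ballI)
    show "finite C0" unfolding C0_def using \<Sigma>(1) by simp
    show "C0 \<subseteq> ?S" unfolding C0_def using C0sub by blast
    fix K assume "K \<in> H ` E"
    then obtain x where x: "x \<in> E" "K = H x" by blast
    obtain t where t: "t \<in> \<Sigma>" "\<phi> t x = x" using meets[OF x(1)] by blast
    then have "{t} \<subseteq> H x" using \<Sigma>(2) unfolding H_def by blast
    then show "\<exists>U\<in>C0. U \<subseteq> K" unfolding C0_def x(2) using gen_le[OF x(1)] t(1) by blast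
  qed
  obtain C \<D> and d :: nat where C: "covers ?S (H ` E) C" and d: "0 < d"
    and low: "\<And>U. U \<in> C \<Longrightarrow> d \<le> V.indep_rank (rat_span U)"
    and \<D>: "\<D> = rat_span ` {U \<in> C. V.indep_rank (rat_span U) = d}" "\<D> \<noteq> {}"
    and inv: "\<And>g. g \<in> carrier G \<Longrightarrow> (`) (conj_rep N G \<pi> (\<pi> g)) ` \<D> = \<D>"
  proof (rule invariant_bottom_of_cover[where F = "H ` E" and \<U> = ?S and s = rat_span and rk = V.indep_rank
        and j = "\<lambda>U U'. generate NG (U \<union> U')" and n = V.dim and A = "carrier G" and c = conj_set
        and \<rho> = "\<lambda>g. conj_rep N G \<pi> (\<pi> g)" and ?C0.0 = C0])
    show "H ` E \<noteq> {}" using E by simp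
    show "generate NG (U \<union> U') \<in> ?S" if "U \<in> ?S" "U' \<in> ?S" for U U'
      using gen_sub[of "U \<union> U'"] that subgroup.subset[of U NG] subgroup.subset[of U' NG] by simp
    show "rat_span U \<subseteq> rat_span (generate NG (U \<union> U'))" for U U'
      by (rule rat_span_mono) (blast intro: generate.incl)
    show "rat_span U' \<subseteq> rat_span (generate NG (U \<union> U'))" for U U'
      by (rule rat_span_mono) (blast intro: generate.incl)
    show "generate NG (U \<union> U') \<subseteq> K" if "K \<in> H ` E" "U \<subseteq> K" "U' \<subseteq> K" for U U' K
      using that gen_le by blast
    show "V.indep_rank (rat_span U) \<le> V.dim" if "U \<in> ?S" for U
      using V.indep_rank_bounds(2)[OF fin_dim rat_span_carrier] that by blast
    show "V.indep_rank (rat_span U) < V.indep_rank (rat_span U')"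
      if "U \<in> ?S" "U' \<in> ?S" "rat_span U \<subset> rat_span U'" for U U'
      using rank_strict_mono[OF _ rat_span_carrier] that by blast
    show "conj_set g U \<in> ?S" if "g \<in> carrier G" "U \<in> ?S" for g U
      using subgroup_conj_set that by blast
    show "rat_span (conj_set g U) = conj_rep N G \<pi> (\<pi> g) ` rat_span U" if "g \<in> carrier G" "U \<in> ?S" for g U
      using conj_rep_rat_span that by blast
    show "V.indep_rank (rat_span U) \<le> V.indep_rank (rat_span (conj_set g U))" if "g \<in> carrier G" "U \<in> ?S" for g U
      using rank_conj_set that by blast
    show "\<exists>H'\<in>H ` E. \<forall>U\<in>?S. U \<subseteq> H' \<longrightarrow> conj_set g U \<subseteq> K" if g: "g \<in> carrier G" and "K \<in> H ` E" for g K
    proof -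
      obtain x where x: "x \<in> E" "K = H x" using \<open>K \<in> H ` E\<close> by blast
      have "\<phi> (inv\<^bsub>G\<^esub> g) x \<in> E" using act.element_image[OF G.inv_closed[OF g] x(1)] by blast
      then show ?thesis using conjH[OF g x(1)] x(2) by blast
    qed
    show "0 < V.indep_rank (rat_span U)" if "U \<in> C0" for U
    proof -
      obtain t where t: "t \<in> \<Sigma>" "U = generate NG {t}" using \<open>U \<in> C0\<close> unfolding C0_def by blast
      show ?thesis unfolding t(2)
        by (rule rank_pos[OF C0sub[OF t(1)] _ \<Sigma>(3)[OF t(1)]]) (auto intro: generate.incl)
    qed
    show "covers ?S (H ` E) C0" by (rule cov)
  qed (rule that)
  have Cfin: "finite C" and CS: "\<And>U. U \<in> C \<Longrightarrow> subgroup U NG" using C unfolding covers_def by blast+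
  have "carrier V \<in> \<D>"
  proof (rule invariant_family_full[OF _ \<D>(2) _ inv])
    show "finite \<D>" unfolding \<D>(1) using Cfin by simp
    fix W assume "W \<in> \<D>"
    then obtain U where U: "U \<in> C" "V.indep_rank (rat_span U) = d" "W = rat_span U" unfolding \<D>(1) by blast
    show "subspace rat_field W V \<and> W \<noteq> {\<zero>\<^bsub>V\<^esub>}"
      using rat_span_subspace[OF CS[OF U(1)]] U(2,3) d V.indep_rank_zero by auto
  qed
  \<comment> \<open>\<open>V\<close> is itself a bottom span, so \<open>d\<close> is its rank. Each
    member of \<open>C\<close> has a span of rank at least \<open>d\<close>, and a proper subspace
    would have smaller rank.\<close>
  then have rank_V: "V.indep_rank (carrier V) = d" unfolding \<D>(1) by force
  have full: "rat_span U = carrier V" if "U \<in> C" for U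
    using rank_strict_mono[OF CS[OF that] subset_refl] rat_span_carrier[OF CS[OF that]] low[OF that] rank_V
    by (metis psubsetI leD)
  obtain x0 where "x0 \<in> E" using E by blast
  then obtain t where t: "t \<in> \<Sigma>" using meets by blast
  then have tN: "t \<in> N" using \<Sigma>(2) by blast
  have tG: "t \<in> carrier G" using tN by simp
  have "\<exists>k::nat. 0 < k \<and> t [^]\<^bsub>G\<^esub> k \<in> U" if "U \<in> C" for U
    by (rule full_span_power[OF nil CS[OF that] full[OF that] tN]) blast
  then obtain k where k: "\<And>U. U \<in> C \<Longrightarrow> 0 < (k U :: nat) \<and> t [^]\<^bsub>G\<^esub> k U \<in> U" by metis
  \<comment> \<open>A common multiple of the finitely many exponents, so that one power of
    \<open>t\<close> lies in every member of \<open>C\<close> and thereby in every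
    stabilizer.\<close>
  define m where "m = prod k C"
  have m: "0 < m" unfolding m_def using k by (intro prod_pos) blast
  have tm: "t [^]\<^bsub>G\<^esub> m \<in> U" if U: "U \<in> C" for U
  proof -
    obtain l where l: "m = k U * l" using dvd_prodI[OF Cfin U, of k] unfolding m_def by (elim dvdE)
    have "(t [^]\<^bsub>G\<^esub> k U) [^]\<^bsub>NG\<^esub> l \<in> U"
      using NG.subgroup_nat_pow_closed[OF CS[OF that]] k[OF that] by blast
    then show ?thesis by (simp add: l pow_NG G.nat_pow_pow[OF tG])
  qed
  have fix_all: "\<phi> (t [^]\<^bsub>G\<^esub> m) x = x" if x: "x \<in> E" for x
  proof -
    obtain U where "U \<in> C" "U \<subseteq> H x" using C x unfolding covers_def by blast
    then show ?thesis using tm unfolding H_def by blast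
  qed
  \<comment> \<open>Group elements act by extensional maps, so agreement on \<open>E\<close> gives
    the equality of functions that faithfulness needs.\<close>
  have "\<phi> (t [^]\<^bsub>G\<^esub> m) = \<phi> \<one>\<^bsub>G\<^esub>"
  proof (rule extensionalityI[of _ E])
    show "\<phi> (t [^]\<^bsub>G\<^esub> m) \<in> extensional E" "\<phi> \<one>\<^bsub>G\<^esub> \<in> extensional E"
      using act.bij_prop0 tG by (auto simp: Bij_def)
    fix x assume "x \<in> E"
    then show "\<phi> (t [^]\<^bsub>G\<^esub> m) x = \<phi> \<one>\<^bsub>G\<^esub> x" using fix_all act.id_eq_one by (metis restrict_apply')
  qed
  then have "t [^]\<^bsub>G\<^esub> m = \<one>\<^bsub>G\<^esub>" using inj_onD[OF act.faithful] tG by simp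
  then show False using \<Sigma>(3)[OF t m] D.one_closed by simp
qed

text \<open>In N^ab the class of \<open>g\<close> is that of \<open>h\<close> times the class of
  h^-1 g, which is torsion. The contrapositive turns injectivity of the projection into infinite
  order in N^ab of the quotients of distinct elements.\<close>

lemma ab_mod_torsion_proj_eq:
  assumes g: "g \<in> N" and h: "h \<in> N" and k: "0 < (k::nat)" "(inv\<^bsub>G\<^esub> h \<otimes>\<^bsub>G\<^esub> g) [^]\<^bsub>G\<^esub> k \<in> D"
  shows "ab_mod_torsion_proj NG g = ab_mod_torsion_proj NG h"
proof -
  have iN: "inv\<^bsub>G\<^esub> h \<in> N" "inv\<^bsub>G\<^esub> h \<otimes>\<^bsub>G\<^esub> g \<in> N" using g h by (simp_all add: N.m_inv_closed N.m_closed)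
  let ?u = "to_ab (inv\<^bsub>G\<^esub> h \<otimes>\<^bsub>G\<^esub> g)"
  have cl: "?u \<in> carrier A" "to_ab g \<in> carrier A" "to_ab h \<in> carrier A" using iN g h carrier_A by auto
  have "?u [^]\<^bsub>A\<^esub> k = to_ab ((inv\<^bsub>G\<^esub> h \<otimes>\<^bsub>G\<^esub> g) [^]\<^bsub>G\<^esub> k)"
    using to_ab.hom_nat_pow[of "inv\<^bsub>G\<^esub> h \<otimes>\<^bsub>G\<^esub> g" k] iN by (simp add: pow_NG)
  also have "\<dots> = \<one>\<^bsub>A\<^esub>"
    using NG.nat_pow_closed[of "inv\<^bsub>G\<^esub> h \<otimes>\<^bsub>G\<^esub> g" k] iN(2) k(2) by (simp add: to_ab_eq_one_iff pow_NG)
  finally have u: "?u \<in> torsion A" unfolding torsion_def using k(1) cl by blast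
  have "subgroup (torsion A) A"
  proof (rule A.subgroupI)
    show "torsion A \<subseteq> carrier A" unfolding torsion_def by blast
    show "torsion A \<noteq> {}" using u by blast
    fix a assume "a \<in> torsion A"
    then obtain i :: nat where i: "a \<in> carrier A" "0 < i" "a [^]\<^bsub>A\<^esub> i = \<one>\<^bsub>A\<^esub>" unfolding torsion_def by blast
    then show "inv\<^bsub>A\<^esub> a \<in> torsion A" unfolding torsion_def
      by (auto intro!: exI[of _ i] simp: A.nat_pow_inv)
    fix b assume "b \<in> torsion A"
    then obtain j :: nat where j: "b \<in> carrier A" "0 < j" "b [^]\<^bsub>A\<^esub> j = \<one>\<^bsub>A\<^esub>" unfolding torsion_def by blast
    have "(a \<otimes>\<^bsub>A\<^esub> b) [^]\<^bsub>A\<^esub> (i * j) = (a [^]\<^bsub>A\<^esub> i) [^]\<^bsub>A\<^esub> j \<otimes>\<^bsub>A\<^esub> (b [^]\<^bsub>A\<^esub> j) [^]\<^bsub>A\<^esub> i"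
      by (simp only: A.nat_pow_distrib[OF i(1) j(1)] A.nat_pow_pow[OF i(1)] A.nat_pow_pow[OF j(1)] mult.commute)
    also have "\<dots> = \<one>\<^bsub>A\<^esub>" by (simp add: i(3) j(3))
    finally show "a \<otimes>\<^bsub>A\<^esub> b \<in> torsion A" unfolding torsion_def
      using i j by (auto intro!: exI[of _ "i * j"])
  qed
  then interpret T: normal "torsion A" A by (simp add: A.normal_iff_subgroup)
  have "?u \<otimes>\<^bsub>A\<^esub> to_ab h = to_ab h \<otimes>\<^bsub>A\<^esub> ?u" using cl by (intro A.m_comm)
  also have "\<dots> = to_ab (h \<otimes>\<^bsub>G\<^esub> (inv\<^bsub>G\<^esub> h \<otimes>\<^bsub>G\<^esub> g))" using to_ab.hom_mult[of h "inv\<^bsub>G\<^esub> h \<otimes>\<^bsub>G\<^esub> g"] h iN by simp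
  also have "h \<otimes>\<^bsub>G\<^esub> (inv\<^bsub>G\<^esub> h \<otimes>\<^bsub>G\<^esub> g) = g" using g h by (simp add: G.inv_cancel_left)
  finally have "torsion A #>\<^bsub>A\<^esub> to_ab g = torsion A #>\<^bsub>A\<^esub> to_ab h"
    using T.rcos_eq_iff[OF cl(2,3)] u by metis
  moreover have "ab_mod_torsion_proj NG n = torsion A #>\<^bsub>A\<^esub> to_ab n" for n
    unfolding ab_mod_torsion_proj_def derived_NG[OF ext] to_ab_def by simp
  ultimately show ?thesis by simp
qed

end

theorem theorem4p9:
  fixes G :: "('g, 'm) monoid_scheme" and Q :: "('q, 'n) monoid_scheme"
    and N L :: "'g set" and \<pi> :: "'g \<Rightarrow> 'q"
  assumes "strongly_irreducible_extension N G Q \<pi>"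
    and "nilpotent_group (G\<lparr>carrier := N\<rparr>)"
    and "L \<subseteq> N"
    and "inj_on (ab_mod_torsion_proj (G\<lparr>carrier := N\<rparr>)) L"
  shows "non_foldable TYPE('x) G L"
proof -
  interpret strongly_irreducible_ext N G Q \<pi> by (rule strongly_irreducible_ext.intro[OF assms(1)])
  have "\<exists>x\<in>E. inj_on (\<lambda>g. \<phi> g x) \<Sigma>"
    if E: "E \<noteq> {}" and act: "faithful_action G E \<phi>" and \<Sigma>: "finite \<Sigma>" "\<Sigma> \<subseteq> L"
    for E :: "'x set" and \<phi> \<Sigma>
  proof (rule ccontr)
    assume no: "\<not> (\<exists>x\<in>E. inj_on (\<lambda>g. \<phi> g x) \<Sigma>)"
    interpret act: faithful_action G E \<phi> by (rule act)
    have \<Sigma>N: "\<Sigma> \<subseteq> N" using \<Sigma>(2) assms(3) by (rule subset_trans)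
    \<comment> \<open>An orbit map at \<open>x\<close> that identifies \<open>g\<close> and
      \<open>h\<close> means that h^-1 g fixes \<open>x\<close>, so \<open>T\<close> meets every
      stabilizer.\<close>
    define T where "T = (\<lambda>(g, h). inv\<^bsub>G\<^esub> h \<otimes>\<^bsub>G\<^esub> g) ` {(g, h) \<in> \<Sigma> \<times> \<Sigma>. g \<noteq> h}"
    have "finite {(g, h) \<in> \<Sigma> \<times> \<Sigma>. g \<noteq> h}"
      by (rule finite_subset[of _ "\<Sigma> \<times> \<Sigma>"]) (use \<Sigma>(1) in auto)
    then have "finite T" unfolding T_def by (rule finite_imageI)
    moreover have "T \<subseteq> N" unfolding T_def using \<Sigma>N N.m_inv_closed N.m_closed by auto
    moreover have "t [^]\<^bsub>G\<^esub> k \<notin> D" if "t \<in> T" and k: "0 < (k::nat)" for t k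
    proof
      assume tk: "t [^]\<^bsub>G\<^esub> k \<in> D"
      obtain g h where gh: "g \<in> \<Sigma>" "h \<in> \<Sigma>" "g \<noteq> h" "t = inv\<^bsub>G\<^esub> h \<otimes>\<^bsub>G\<^esub> g" using \<open>t \<in> T\<close> unfolding T_def by auto
      have "ab_mod_torsion_proj NG g = ab_mod_torsion_proj NG h"
        using ab_mod_torsion_proj_eq[of g h k] gh \<Sigma>N k tk by blast
      then show False using inj_onD[OF assms(4)] gh \<Sigma>(2) by blast
    qed
    moreover have "\<exists>t\<in>T. \<phi> t x = x" if x: "x \<in> E" for x
    proof -
      obtain g h where gh: "g \<in> \<Sigma>" "h \<in> \<Sigma>" "g \<noteq> h" "\<phi> g x = \<phi> h x"
        using no x unfolding inj_on_def by blast
      have G: "g \<in> carrier G" "h \<in> carrier G" using gh \<Sigma>N by auto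
      have "\<phi> (inv\<^bsub>G\<^esub> h \<otimes>\<^bsub>G\<^esub> g) x = \<phi> (inv\<^bsub>G\<^esub> h) (\<phi> h x)"
        unfolding gh(4)[symmetric] using x G by (intro act.composition_rule) auto
      also have "\<dots> = \<phi> (inv\<^bsub>G\<^esub> h \<otimes>\<^bsub>G\<^esub> h) x" using x G by (intro act.composition_rule[symmetric]) auto
      also have "\<dots> = x" using x G act.id_eq_one by (metis G.l_inv restrict_apply')
      finally have "\<phi> (inv\<^bsub>G\<^esub> h \<otimes>\<^bsub>G\<^esub> g) x = x" .
      then show ?thesis unfolding T_def using gh(1-3) by force
    qed
    ultimately show False by (rule stabilizer_meets_imp_trivial_power[OF assms(2) E act])
  qed
  moreover have "L \<subseteq> carrier G" using assms(3) N.subset by (rule subset_trans)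
  ultimately show ?thesis unfolding non_foldable_def by blast
qed

end
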